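(* Let $\mathcal H$ be a finite-dimensional complex Hilbert space, let $1<p<\infty$, and let $\mathcal K$ be a subset of the set of Lindbladians on $\mathbb B(\mathcal H)$. Let $\sigma\in\mathcal D(\mathcal H)$. Suppose there is a Lindbladian vector field in $\mathcal K$, i.e. an assignment $\eta\mapsto L_\eta\in\mathcal K$ for $\eta\in\mathcal D(\mathcal H)$, such that for all $\eta\in\mathcal D(\mathcal H)$ with $\eta\ne\sigma$, $$\mathrm{tr}\big(L_\eta(\eta)\,(\eta-\sigma)\,|\eta-\sigma|^{p-2}\big)<0 .$$ Then $\mathcal K$ reaches $\sigma$.
   Context: $\mathbb B(\mathcal H)$ is the algebra of linear operators on $\mathcal H$; $\mathcal D(\mathcal H)=\{\rho\in\mathbb B(\mathcal H):\rho=\rho^*,\rho\ge 0,\mathrm{tr}\,\rho=1\}$. For Hermitian $x$, $x|x|^{p-2}$ is defined by functional calculus from $s\mapsto \mathrm{sgn}(s)|s|^{p-1}$. A Lindbladian is a linear map on $\mathbb B(\mathcal H)$ of the form $L(\rho)=-i[H,\rho]+\sum_{j=1}^n\big(L_j\rho L_j^*-\tfrac12(L_j^*L_j\rho+\rho L_j^*L_j)\big)$ with $H=H^*$ and $L_j\in\mathbb B(\mathcal H)$. An evolution $(T_t)_{t\ge 0}$ (maps on $\mathbb B(\mathcal H)$ with $T_0=\mathrm{id}$) is admissible to $\mathcal K$ if there is a family $L_t\in\mathcal K$, for all $t$, such that $T_t$ is a weak solution of $\dot T_t=L_tT_t$. $\mathcal K$ reaches $\sigma$ if for every initial state $\rho\in\mathcal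 D(\mathcal H)$ there is a time-dependent Lindbladian evolution $T_t$ admissible to $\mathcal K$ with $\lim_{t\to\infty}T_t(\rho)=\sigma$. *)

theory Defs
  imports "HOL-Analysis.Analysis"
begin

text \<open>
  The Hilbert space is \<open>complex ^ 'n\<close> with its standard inner product, for an arbitrary
  finite index type \<open>'n\<close>, and its operator algebra is the algebra of complex matrices over \<open>'n\<close>.
  (The zero space is not of this form, but it carries no states.)
\<close>

type_synonym 'n op = "complex ^ 'n ^ 'n"
type_synonym 'n superop = "'n::finite op \<Rightarrow> 'n op"

definition csmult :: "complex \<Rightarrow> 'n::finite op \<Rightarrow> 'n op" where
  "csmult c A = (\<chi> i j. c * A $ i $ j)"

definition adj :: "'n::finite op \<Rightarrow> 'n op" where
  "adj A = (\<chi> i j. cnj (A $ j $ i))"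

definition hermitian :: "'n::finite op \<Rightarrow> bool" where
  "hermitian A \<longleftrightarrow> adj A = A"

definition unitary :: "'n::finite op \<Rightarrow> bool" where
  "unitary U \<longleftrightarrow> adj U ** U = mat 1 \<and> U ** adj U = mat 1"

definition cinner :: "complex ^ 'n::finite \<Rightarrow> complex ^ 'n \<Rightarrow> complex" where
  "cinner v w = (\<Sum>i\<in>UNIV. cnj (v $ i) * w $ i)"

text \<open>The form of a Hermitian operator is real-valued, so taking the real part loses nothing.\<close>

definition positive_op :: "'n::finite op \<Rightarrow> bool" where
  "positive_op A \<longleftrightarrow> hermitian A \<and> (\<forall>v. 0 \<le> Re (cinner v (A *v v)))"

definition states :: "'n::finite op set" where
  "states = {\<rho>. positive_op \<rho> \<and> trace \<rho> = 1}"

definition real_diag :: "('n::finite \<Rightarrow> real) \<Rightarrow> 'n op" where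
  "real_diag d = (\<chi> i j. if i = j then complex_of_real (d i) else 0)"

text \<open>
  Functional calculus of a Hermitian operator by unitary diagonalisation; the value does not
  depend on the diagonalisation.  For operators that are not Hermitian it is unspecified.
\<close>

definition fun_calc :: "(real \<Rightarrow> real) \<Rightarrow> 'n::finite op \<Rightarrow> 'n op" where
  "fun_calc f X =
     (THE Y. \<exists>U d. unitary U \<and> X = U ** real_diag d ** adj U \<and>
                   Y = U ** real_diag (\<lambda>i. f (d i)) ** adj U)"

text \<open>The operator \<open>x |x|\<^sup>p\<^sup>-\<^sup>2\<close>, also for \<open>p < 2\<close>, where \<open>|x|\<^sup>p\<^sup>-\<^sup>2\<close> alone need not make sense.\<close>

definition signed_power :: "real \<Rightarrow> 'n::finite op \<Rightarrow> 'n op" where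
  "signed_power p X = fun_calc (\<lambda>s. sgn s * \<bar>s\<bar> powr (p - 1)) X"

definition lindblad_form ::
    "'n::finite op \<Rightarrow> nat \<Rightarrow> (nat \<Rightarrow> 'n op) \<Rightarrow> 'n superop" where
  "lindblad_form H n V \<rho> =
     csmult (- \<i>) (H ** \<rho> - \<rho> ** H) +
     (\<Sum>j = 1..n. V j ** \<rho> ** adj (V j)
        - (1/2) *\<^sub>R (adj (V j) ** V j ** \<rho> + \<rho> ** (adj (V j) ** V j)))"

definition lindbladians :: "'n::finite superop set" where
  "lindbladians = {lindblad_form H n V | H n V. hermitian H}"

text \<open>
  Weak solutions of \<open>dT\<^sub>t/dt = L\<^sub>t T\<^sub>t\<close> on \<open>[0,\<infinity>)\<close> are taken in integrated (Caratheodory) form: the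
  right-hand side is locally Lebesgue integrable and \<open>T\<close> is an indefinite integral of it.  This is
  the continuous representative of a distributional solution with locally integrable right-hand
  side; no regularity in \<open>t\<close> is imposed on the generators themselves.
\<close>

definition weak_solution :: "(real \<Rightarrow> 'n::finite superop) \<Rightarrow> (real \<Rightarrow> 'n superop) \<Rightarrow> bool" where
  "weak_solution L T \<longleftrightarrow>
     (\<forall>x. \<forall>t\<ge>0. set_integrable lborel {0..t} (\<lambda>s. L s (T s x)) \<and>
                 T t x = T 0 x + (LINT s:{0..t}|lborel. L s (T s x)))"

text \<open>Only the values of \<open>T\<close> at times \<open>t \<ge> 0\<close> are meaningful.\<close>

definition evolution :: "(real \<Rightarrow> 'n::finite superop) \<Rightarrow> bool" where
  "evolution T \<longleftrightarrow> T 0 = id \<and> (\<forall>t\<ge>0. Vector_Spaces.linear csmult csmult (T t))"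

definition admissible :: "'n::finite superop set \<Rightarrow> (real \<Rightarrow> 'n superop) \<Rightarrow> bool" where
  "admissible K T \<longleftrightarrow>
     evolution T \<and> (\<exists>L. (\<forall>t\<ge>0. L t \<in> K) \<and> weak_solution L T)"

definition reaches :: "'n::finite superop set \<Rightarrow> 'n op \<Rightarrow> bool" where
  "reaches K \<sigma> \<longleftrightarrow>
     (\<forall>\<rho>\<in>states. \<exists>T. admissible K T \<and> ((\<lambda>t. T t \<rho>) \<longlongrightarrow> \<sigma>) at_top)"

end

theory Submission
  imports Defs
begin

text \<open>
  The Lyapunov function is \<open>W \<eta> = tr |\<eta> - \<sigma>|\<^sup>p\<close>.  Klein's inequality bounds its increments by its
  gradient at the later point, and the gradient is continuous, so each \<open>L \<eta>\<close>, run for a short time,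
  decreases \<open>W\<close> by a definite amount from all states near \<open>\<eta>\<close>.  By compactness finitely many of
  these generators suffice away from \<open>\<sigma>\<close>, hence a piecewise constant control brings \<open>W\<close> below any
  level in finite time.  As these times may be summable, the control also idles: the motion caused by
  a fixed generator is slow enough to spend unit time below each level before the next descent.
\<close>

section \<open>Diagonalisation of Hermitian matrices\<close>

text \<open>The assignment of \<open>L \<eta>\<close> to \<eta> carries no regularity, so the
  closed-loop equation cannot simply be solved; this is why generators are frozen, and why a descent
  has to work on a whole neighbourhood of \<eta>. To avoid differentiating a spectral function, the
  later point is held fixed in Klein's inequality: what remains is linear in the moving state, and
  the mean value theorem applies to it. All compactness arguments live on \<open>states\<close>,
  hence the need for the flows to stay there. \<open>K\<close> need not contain the zero generator,
  so waiting in place may be impossible and idling has to be compensated by renewed descents. The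
  control is designed for one initial state, but an evolution acts on all operators and for all
  times; finite plans therefore record whole superoperators and are glued in the end.\<close>

lemma csmult_nth [simp]: "csmult c A $ i $ j = c * A $ i $ j"
  by (simp add: csmult_def)

lemma adj_nth [simp]: "adj A $ i $ j = cnj (A $ j $ i)"
  by (simp add: adj_def)

lemma matrix_mult_nth: "(A ** B) $ i $ j = (\<Sum>k\<in>UNIV. A $ i $ k * B $ k $ j)"
  by (simp add: matrix_matrix_mult_def)

lemma adj_adj [simp]: "adj (adj A) = A"
  by (simp add: vec_eq_iff)

lemma adj_mult: "adj (A ** B) = adj B ** adj A"
  by (simp add: vec_eq_iff matrix_mult_nth mult.commute)

lemma adj_zero [simp]: "adj 0 = 0"
  by (simp add: vec_eq_iff)

lemma adj_add: "adj (A + B) = adj A + adj B"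
  by (simp add: vec_eq_iff)

lemma adj_diff: "adj (A - B) = adj A - adj B"
  by (simp add: vec_eq_iff)

lemma adj_scaleR: "adj (c *\<^sub>R A) = c *\<^sub>R adj A"
  by (simp add: vec_eq_iff)

lemma adj_csmult: "adj (csmult c A) = csmult (cnj c) (adj A)"
  by (simp add: vec_eq_iff)

lemma adj_sum: "adj (\<Sum>i\<in>I. A i) = (\<Sum>i\<in>I. adj (A i))"
  by (induction I rule: infinite_finite_induct) (simp_all add: adj_add)

lemma bounded_linear_adj: "bounded_linear (adj :: 'n::finite op \<Rightarrow> 'n op)"
  by (intro linear_conv_bounded_linear[THEN iffD1] linearI) (simp_all add: adj_add adj_scaleR)

lemma bounded_bilinear_matrix_mult:
  "bounded_bilinear ((**) :: 'n::finite op \<Rightarrow> 'n op \<Rightarrow> 'n op)"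
  unfolding bilinear_conv_bounded_bilinear[symmetric] bilinear_def
  by (auto intro!: linearI
      simp: vec_eq_iff matrix_mult_nth sum.distrib scaleR_sum_right distrib_left distrib_right)

lemma bounded_linear_trace: "bounded_linear (trace :: 'n::finite op \<Rightarrow> complex)"
  by (intro linear_conv_bounded_linear[THEN iffD1] linearI)
    (simp_all add: trace_def sum.distrib scaleR_sum_right)

lemmas continuous_on_adj [continuous_intros] = bounded_linear.continuous_on[OF bounded_linear_adj]
lemmas continuous_on_matrix_mult [continuous_intros] =
  bounded_bilinear.continuous_on[OF bounded_bilinear_matrix_mult]
lemmas continuous_on_trace [continuous_intros] =
  bounded_linear.continuous_on[OF bounded_linear_trace]

section \<open>Inner product, matrix forms and unitary matrices\<close>

lemma cinner_add_right: "cinner v (w + w') = cinner v w + cinner v w'"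
  and cinner_add_left: "cinner (v + v') w = cinner v w + cinner v' w"
  and cinner_smult_right: "cinner v (c *s w) = c * cinner v w"
  and cinner_smult_left: "cinner (c *s v) w = cnj c * cinner v w"
  by (simp_all add: cinner_def sum.distrib algebra_simps sum_distrib_left)

lemma cinner_zero [simp]: "cinner v 0 = 0" "cinner 0 v = 0"
  by (simp_all add: cinner_def)

lemma cnj_cinner: "cnj (cinner v w) = cinner w v"
  by (simp add: cinner_def mult.commute)

lemma cinner_self: "cinner v v = complex_of_real ((norm v)\<^sup>2)"
proof -
  have "(norm v)\<^sup>2 = (\<Sum>i\<in>UNIV. (cmod (v $ i))\<^sup>2)"
    by (simp add: norm_vec_def L2_set_def sum_nonneg)
  then show ?thesis
    by (simp add: cinner_def complex_norm_square mult.commute del: of_real_power)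
qed

lemma cinner_adj: "cinner v (A *v w) = cinner (adj A *v v) w"
proof -
  have "cinner v (A *v w) = (\<Sum>i\<in>UNIV. \<Sum>j\<in>UNIV. cnj (v $ i) * (A $ i $ j * w $ j))"
    by (simp add: cinner_def matrix_vector_mult_def sum_distrib_left)
  also have "\<dots> = (\<Sum>j\<in>UNIV. \<Sum>i\<in>UNIV. cnj (v $ i) * (A $ i $ j * w $ j))"
    by (rule sum.swap)
  also have "\<dots> = cinner (adj A *v v) w"
    by (simp add: cinner_def matrix_vector_mult_def sum_distrib_left sum_distrib_right mult_ac)
  finally show ?thesis .
qed

text \<open>Conjugate linearity in the first slot is still linearity over the reals, which is all
  that \<open>bounded_bilinear\<close> asks for.\<close>

lemma bounded_bilinear_cinner: "bounded_bilinear (cinner :: complex ^ 'n::finite \<Rightarrow> _)"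
  unfolding bilinear_conv_bounded_bilinear[symmetric] bilinear_def
  by (auto intro!: linearI simp: cinner_def sum.distrib scaleR_sum_right distrib_left distrib_right)

lemma bounded_bilinear_matrix_vector_mult:
  "bounded_bilinear ((*v) :: 'n::finite op \<Rightarrow> complex ^ 'n \<Rightarrow> complex ^ 'n)"
  unfolding bilinear_conv_bounded_bilinear[symmetric] bilinear_def
  by (auto intro!: linearI
      simp: vec_eq_iff matrix_vector_mult_def sum.distrib scaleR_sum_right distrib_left distrib_right)

lemmas continuous_on_cinner [continuous_intros] =
  bounded_bilinear.continuous_on[OF bounded_bilinear_cinner]
lemmas continuous_on_matrix_vector_mult [continuous_intros] =
  bounded_bilinear.continuous_on[OF bounded_bilinear_matrix_vector_mult]

text \<open>Conjugation by \<open>U\<close> becomes evaluation of the form of \<open>X\<close> on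
  columns of \<open>U\<close>, so a change of two columns can be followed entry by entry.\<close>

lemma adj_mult_mult_nth:
  "(adj U ** X ** U) $ i $ j = cinner (column i U) (X *v column j U)"
  by (simp add: matrix_mul_assoc[symmetric])
    (simp add: cinner_def matrix_vector_mult_def matrix_mult_nth column_def)

lemma adj_mult_self_nth: "(adj U ** U) $ i $ j = cinner (column i U) (column j U)"
  using adj_mult_mult_nth[of U "mat 1"] by simp

lemma unitary_iff: "unitary U \<longleftrightarrow> adj U ** U = mat 1"
  by (auto simp: unitary_def matrix_left_right_inverse)

lemma unitary_iff_columns:
  "unitary U \<longleftrightarrow> (\<forall>i j. cinner (column i U) (column j U) = (if i = j then 1 else 0))"
  by (simp add: unitary_iff vec_eq_iff adj_mult_self_nth mat_def)

lemma unitary_entry_bound: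
  assumes "unitary U"
  shows "cmod (U $ i $ j) \<le> 1"
proof -
  have "complex_of_real ((norm (column j U))\<^sup>2) = 1"
    using assms unfolding cinner_self[symmetric] by (simp add: unitary_iff_columns)
  then have "(norm (column j U))\<^sup>2 = 1"
    using of_real_eq_1_iff by blast
  then have "norm (column j U) = 1"
    by (simp add: power2_eq_1_iff) (use norm_ge_zero[of "column j U"] in linarith)
  then show ?thesis
    using Finite_Cartesian_Product.norm_nth_le[of "column j U" i] by (simp add: column_def)
qed

lemma bounded_entries:
  fixes S :: "'n::finite op set"
  assumes "\<And>A i j. A \<in> S \<Longrightarrow> cmod (A $ i $ j) \<le> B"
  shows "bounded S"
proof -
  have "norm A \<le> (\<Sum>i\<in>(UNIV::'n set). \<Sum>j\<in>(UNIV::'n set). B)" if "A \<in> S" for A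
  proof -
    have "norm A \<le> (\<Sum>i\<in>UNIV. norm (A $ i))"
      unfolding norm_vec_def by (rule L2_set_le_sum) simp
    also have "\<dots> \<le> (\<Sum>i\<in>UNIV. \<Sum>j\<in>UNIV. norm (A $ i $ j))"
      by (intro sum_mono) (simp add: norm_vec_def L2_set_le_sum)
    also have "\<dots> \<le> (\<Sum>i\<in>(UNIV::'n set). \<Sum>j\<in>(UNIV::'n set). B)"
      by (intro sum_mono assms[OF that])
    finally show ?thesis .
  qed
  then show ?thesis
    by (auto simp: bounded_iff)
qed

lemma compact_unitary: "compact {U :: 'n::finite op. unitary U}"
proof -
  have "closed {U :: 'n op. adj U ** U = mat 1}"
    by (intro closed_Collect_eq continuous_intros)
  moreover have "bounded {U :: 'n op. unitary U}"
    by (rule bounded_entries[of _ 1]) (simp add: unitary_entry_bound)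
  ultimately show ?thesis
    by (simp add: compact_eq_bounded_closed unitary_iff)
qed

text \<open>
  With distinct weights, a maximiser of the weighted trace diagonalises \<open>X\<close>: a Givens rotation of two
  columns of \<open>U\<close> changes it to first order in the angle unless the off-diagonal entry vanishes.
\<close>

lemma weighted_trace_increase:
  fixes X U :: "'n::finite op" and w :: "'n \<Rightarrow> real"
  defines "f \<equiv> \<lambda>U. \<Sum>i\<in>UNIV. w i * Re ((adj U ** X ** U) $ i $ i)"
  assumes X: "hermitian X" and U: "unitary U"
    and w: "w b < w a" and nz: "(adj U ** X ** U) $ a $ b \<noteq> 0"
  shows "\<exists>U'. unitary U' \<and> f U < f U'"
proof -
  define q where "q = (\<lambda>v v'. cinner v (X *v v'))"
  have q_add: "q (v + v') x = q v x + q v' x" "q x (v + v') = q x v + q x v'"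
    and q_smult: "q (c *s v) x = cnj c * q v x" "q x (c *s v) = c * q x v" for v v' x c
    by (simp_all add: q_def cinner_add_left cinner_add_right cinner_smult_left cinner_smult_right
        matrix_vector_right_distrib vector_scalar_commute)
  define u where "u = (\<lambda>i. column i U)"
  define y where "y = q (u a) (u b)"
  have ab: "a \<noteq> b" using w by auto
  have y0: "y \<noteq> 0"
    using nz by (simp add: adj_mult_mult_nth y_def q_def u_def)
  have yba: "q (u b) (u a) = cnj y"
    using X by (simp add: y_def q_def cnj_cinner hermitian_def cinner_adj[of _ X])
  \<comment> \<open>The phase that makes \<open>z * y\<close> real and positive, so that the
    first-order term of the rotated diagonal entry has a definite sign.\<close>
  define z where "z = cnj y / cmod y"
  have zy: "z * y = cmod y" "cnj z * z = 1" "z * cnj z = 1" "cnj y * cnj z = cmod y"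
    using y0 complex_norm_square[of y]
    by (auto simp: z_def field_simps power2_eq_square)
  define D where "D = \<bar>Re (q (u a) (u a)) - Re (q (u b) (u b))\<bar>"
  \<comment> \<open>The tangent of the rotation angle; \<open>c\<close> and \<open>s\<close> are the
    cosine and the sine. Since \<open>\<tau> * D + \<tau> = cmod y\<close>, the second-order loss
    stays below the first-order gain \<open>2 * cmod y\<close>.\<close>
  define \<tau> where "\<tau> = cmod y / (D + 1)"
  define c where "c = 1 / sqrt (1 + \<tau>\<^sup>2)"
  define s where "s = \<tau> * c"
  have pos: "0 < \<tau>" "0 < c"
    using y0 by (auto simp: \<tau>_def c_def D_def add_pos_nonneg add_nonneg_pos intro!: divide_pos_pos)
  have cs: "c\<^sup>2 + s\<^sup>2 = 1"
  proof -
    have "c\<^sup>2 * (1 + \<tau>\<^sup>2) = 1"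
      using sum_power2_gt_zero_iff[of 1 \<tau>] by (simp add: c_def power_divide)
    then show ?thesis by (simp add: s_def power_mult_distrib algebra_simps)
  qed
  define U' where "U' = (\<chi> r k. if k = a then c * U $ r $ a + s * z * U $ r $ b
      else if k = b then c * U $ r $ b - s * cnj z * U $ r $ a else U $ r $ k)"
  define u' where "u' = (\<lambda>i. column i U')"
  have u'a: "u' a = complex_of_real c *s u a + (s * z) *s u b"
    and u'b: "u' b = complex_of_real c *s u b + (- s * cnj z) *s u a"
    and u'k: "\<And>k. k \<noteq> a \<Longrightarrow> k \<noteq> b \<Longrightarrow> u' k = u k"
    using ab by (auto simp: u'_def u_def U'_def column_def vec_eq_iff)
  have on: "cinner (u i) (u j) = (if i = j then 1 else 0)" for i j
    using U by (simp add: unitary_iff_columns u_def)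
  have csc: "complex_of_real c * complex_of_real c + complex_of_real s * complex_of_real s = 1"
    using cs by (metis of_real_1 of_real_add of_real_mult power2_eq_square)
  note sesqui = cinner_add_left cinner_add_right cinner_smult_left cinner_smult_right
  have aa: "cinner (u' a) (u' a) = 1"
  proof -
    have "cinner (u' a) (u' a)
        = complex_of_real c * complex_of_real c + complex_of_real s * complex_of_real s * (cnj z * z)"
      using ab by (simp only: u'a sesqui on) simp
    then show ?thesis by (simp only: zy csc mult_1_right)
  qed
  have bb: "cinner (u' b) (u' b) = 1"
  proof -
    have "cinner (u' b) (u' b)
        = complex_of_real c * complex_of_real c + complex_of_real s * complex_of_real s * (z * cnj z)"
      using ab by (simp only: u'b sesqui on) simp
    then show ?thesis by (simp only: zy csc mult_1_right)
  qed
  have ab0: "cinner (u' a) (u' b) = 0" "cinner (u' b) (u' a) = 0"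
    using ab by (simp_all only: u'a u'b sesqui on) simp_all
  have rest: "cinner (u' a) (u k) = 0" "cinner (u k) (u' a) = 0"
    "cinner (u' b) (u k) = 0" "cinner (u k) (u' b) = 0" if "k \<noteq> a" "k \<noteq> b" for k
    using that by (simp_all only: u'a u'b sesqui on) auto
  have "cinner (u' i) (u' j) = (if i = j then 1 else 0)" for i j
    using ab by (cases "i = a"; cases "i = b"; cases "j = a"; cases "j = b")
      (simp_all add: aa bb ab0 rest u'k on)
  then have "unitary U'"
    by (simp add: unitary_iff_columns u'_def)
  moreover have "f U < f U'"
  proof -
    define A where "A = Re (q (u a) (u a))"
    define B where "B = Re (q (u b) (u b))"
    \<comment> \<open>The amount that the rotation moves from the diagonal entry at \<open>b\<close>
      to the one at \<open>a\<close>. Their sum is conserved, so the weighted trace changes by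
      \<open>(w a - w b) * \<delta>\<close>.\<close>
    define \<delta> where "\<delta> = s\<^sup>2 * (B - A) + 2 * c * s * cmod y"
    have qa: "Re (q (u' a) (u' a)) = A + \<delta>"
    proof -
      have "q (u' a) (u' a) = c\<^sup>2 * q (u a) (u a) + s\<^sup>2 * (cnj z * z) * q (u b) (u b)
          + c * s * (z * y) + c * s * (cnj y * cnj z)"
        by (simp add: u'a q_add q_smult yba y_def[symmetric] algebra_simps power2_eq_square)
      then have "Re (q (u' a) (u' a)) = c\<^sup>2 * A + s\<^sup>2 * B + 2 * c * s * cmod y"
        by (simp add: zy A_def B_def flip: of_real_power)
      moreover have "c\<^sup>2 = 1 - s\<^sup>2" using cs by simp
      ultimately show ?thesis by (simp add: \<delta>_def algebra_simps)
    qed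
    have qb: "Re (q (u' b) (u' b)) = B - \<delta>"
    proof -
      have "q (u' b) (u' b) = c\<^sup>2 * q (u b) (u b) + s\<^sup>2 * (z * cnj z) * q (u a) (u a)
          - c * s * (z * y) - c * s * (cnj y * cnj z)"
        by (simp only: u'b q_add q_smult yba y_def[symmetric])
          (simp add: algebra_simps power2_eq_square)
      then have "Re (q (u' b) (u' b)) = c\<^sup>2 * B + s\<^sup>2 * A - 2 * c * s * cmod y"
        by (simp add: zy A_def B_def flip: of_real_power)
      moreover have "c\<^sup>2 = 1 - s\<^sup>2" using cs by simp
      ultimately show ?thesis by (simp add: \<delta>_def algebra_simps)
    qed
    have "f V = w a * Re (q (column a V) (column a V)) + w b * Re (q (column b V) (column b V))
        + (\<Sum>i\<in>UNIV - {a, b}. w i * Re (q (column i V) (column i V)))" for V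
    proof -
      have "f V = (\<Sum>i\<in>UNIV. w i * Re (q (column i V) (column i V)))"
        by (simp add: f_def adj_mult_mult_nth q_def)
      also have "\<dots> = (\<Sum>i\<in>{a, b}. w i * Re (q (column i V) (column i V)))
          + (\<Sum>i\<in>UNIV - {a, b}. w i * Re (q (column i V) (column i V)))"
        using sum.subset_diff[of "{a,b}" UNIV] by (simp add: add.commute)
      finally show ?thesis using ab by simp
    qed
    note f = this[of U] this[of U']
    have r: "(\<Sum>i\<in>UNIV - {a, b}. w i * Re (q (u' i) (u' i)))
        = (\<Sum>i\<in>UNIV - {a, b}. w i * Re (q (u i) (u i)))" (is "_ = ?r")
      by (intro sum.cong) (auto simp: u'k)
    have "f U' - f U = (w a - w b) * \<delta>"
    proof -
      have "f U = w a * A + w b * B + ?r" "f U' = w a * (A + \<delta>) + w b * (B - \<delta>) + ?r"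
        using f qa qb r by (simp_all only: A_def B_def u_def u'_def)
      then show ?thesis by (simp only:) (simp add: algebra_simps)
    qed
    moreover have "0 < \<delta>"
    proof -
      have "\<tau> * (A - B) \<le> \<tau> * D"
        using pos by (simp add: D_def A_def B_def)
      also have "\<dots> < 2 * cmod y"
      proof -
        have "\<tau> * (D + 1) = cmod y"
          by (simp add: \<tau>_def D_def add_nonneg_pos)
        moreover have "0 < cmod y" using y0 by simp
        ultimately have "\<tau> * D + \<tau> = cmod y" "0 < cmod y"
          by (simp_all add: algebra_simps)
        then show ?thesis using pos by linarith
      qed
      finally have "0 < c * s * (2 * cmod y - \<tau> * (A - B))"
        using pos by (simp add: s_def)
      also have "\<dots> = \<delta>"
        by (simp add: \<delta>_def s_def power2_eq_square algebra_simps)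
      finally show ?thesis .
    qed
    ultimately have "0 < f U' - f U" using w by simp
    then show ?thesis by simp
  qed
  ultimately show ?thesis by blast
qed

lemma unitary_conj_eq:
  assumes "unitary U"
  shows "U ** (adj U ** X ** U) ** adj U = X"
  using assms by (metis matrix_mul_assoc matrix_mul_lid matrix_mul_rid unitary_def)

theorem hermitian_diagonalization:
  fixes X :: "'n::finite op"
  assumes X: "hermitian X"
  shows "\<exists>U d. unitary U \<and> X = U ** real_diag d ** adj U"
proof -
  \<comment> \<open>An injective numbering of the indices supplies the distinct weights; equal
    weights would leave an off-diagonal entry unconstrained.\<close>
  obtain w0 :: "'n \<Rightarrow> nat" where "inj w0"
    using finite_imp_inj_to_nat_seg[OF finite] by metis
  define w where "w = (\<lambda>i. real (w0 i))"
  define f where "f = (\<lambda>U. \<Sum>i\<in>UNIV. w i * Re ((adj U ** X ** U) $ i $ i))"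
  have "adj (mat 1) = (mat 1 :: 'n op)"
    by (simp add: vec_eq_iff mat_def)
  then have "unitary (mat 1 :: 'n op)"
    by (simp add: unitary_iff)
  moreover have "continuous_on {U. unitary U} f"
    unfolding f_def by (intro continuous_intros)
  ultimately obtain U where U: "unitary U" and max: "\<And>V. unitary V \<Longrightarrow> f V \<le> f U"
    using continuous_attains_sup[OF compact_unitary, of f] by blast
  define Y where "Y = adj U ** X ** U"
  have Y: "adj Y = Y"
    using X by (simp add: Y_def adj_mult hermitian_def matrix_mul_assoc)
  have lt: "Y $ a $ b = 0" if "w b < w a" for a b
    using weighted_trace_increase[OF X U that] max by (force simp: Y_def f_def)
  have off: "Y $ a $ b = 0" if "a \<noteq> b" for a b
  proof -
    have "w b \<noteq> w a" using that \<open>inj w0\<close> by (auto simp: w_def inj_def)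
    moreover have "Y $ a $ b = cnj (Y $ b $ a)" using Y by (metis adj_nth)
    ultimately show ?thesis using lt[of a b] lt[of b a] by fastforce
  qed
  have "Y $ a $ a = complex_of_real (Re (Y $ a $ a))" for a
    using Y by (metis adj_nth Reals_cnj_iff of_real_Re)
  then have "Y = real_diag (\<lambda>i. Re (Y $ i $ i))"
    by (auto simp: vec_eq_iff real_diag_def off)
  then show ?thesis
    using U unitary_conj_eq[OF U, of X] unfolding Y_def[symmetric] by metis
qed

section \<open>Functional calculus and Klein's inequality\<close>

lemma unitary_cancel:
  assumes "unitary U"
  shows "adj U ** U = mat 1" "U ** adj U = mat 1" "adj U ** (U ** X) = X" "U ** (adj U ** X) = X"
  using assms by (simp_all add: unitary_def matrix_mul_assoc)

lemma unitary_mult: "unitary U \<Longrightarrow> unitary V \<Longrightarrow> unitary (U ** V)"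
  by (simp add: unitary_iff adj_mult matrix_mul_assoc[symmetric] unitary_cancel)

lemma unitary_adj: "unitary U \<Longrightarrow> unitary (adj U)"
  by (simp add: unitary_def)

lemma real_diag_mult_nth: "(real_diag d ** M) $ i $ j = d i * M $ i $ j"
  and mult_real_diag_nth: "(M ** real_diag d) $ i $ j = M $ i $ j * d j"
  by (simp_all add: matrix_mult_nth real_diag_def if_distrib if_distribR sum.delta cong: if_cong)

text \<open>Makes the definite description in \<open>fun_calc\<close> usable. Two diagonalisations
  of \<open>X\<close> are linked by the intertwiner \<open>M\<close>, whose entries vanish unless
  the corresponding eigenvalues coincide; hence \<open>M\<close> also intertwines the diagonals
  after \<open>f\<close> is applied.\<close>

lemma fun_calc_eq:
  fixes U X :: "'n::finite op"
  assumes U: "unitary U" and X: "X = U ** real_diag d ** adj U"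
  shows "fun_calc f X = U ** real_diag (\<lambda>i. f (d i)) ** adj U"
  unfolding fun_calc_def
proof (rule the_equality)
  show "\<exists>V e. unitary V \<and> X = V ** real_diag e ** adj V \<and>
      U ** real_diag (\<lambda>i. f (d i)) ** adj U = V ** real_diag (\<lambda>i. f (e i)) ** adj V"
    using assms by blast
next
  fix Y
  assume "\<exists>V e. unitary V \<and> X = V ** real_diag e ** adj V \<and>
      Y = V ** real_diag (\<lambda>i. f (e i)) ** adj V"
  then obtain V e where V: "unitary V" and XV: "X = V ** real_diag e ** adj V"
    and Y: "Y = V ** real_diag (\<lambda>i. f (e i)) ** adj V"
    by blast
  define M where "M = adj V ** U"
  have "real_diag e ** M = adj V ** X ** U"
    by (simp add: M_def XV matrix_mul_assoc[symmetric] unitary_cancel[OF V])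
  also have "\<dots> = M ** real_diag d"
    by (simp add: M_def X matrix_mul_assoc[symmetric] unitary_cancel[OF U])
  finally have "of_real (e i) * M $ i $ j = M $ i $ j * of_real (d j)" for i j
    by (metis real_diag_mult_nth mult_real_diag_nth)
  then have "M $ i $ j = 0 \<or> e i = d j" for i j
    by (metis mult.commute mult_cancel_left of_real_eq_iff)
  then have "of_real (f (e i)) * M $ i $ j = M $ i $ j * of_real (f (d j))" for i j
    by (metis mult.commute mult_zero_left mult_zero_right)
  then have *: "real_diag (\<lambda>i. f (e i)) ** M = M ** real_diag (\<lambda>i. f (d i))"
    by (simp add: vec_eq_iff real_diag_mult_nth mult_real_diag_nth)
  have "Y = V ** (real_diag (\<lambda>i. f (e i)) ** M) ** adj U"
    by (simp add: Y M_def matrix_mul_assoc[symmetric] unitary_cancel[OF U])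
  also have "\<dots> = U ** real_diag (\<lambda>i. f (d i)) ** adj U"
    unfolding * by (simp add: M_def matrix_mul_assoc[symmetric] unitary_cancel[OF V])
  finally show "Y = U ** real_diag (\<lambda>i. f (d i)) ** adj U" .
qed

lemma unitary_column_sum: "unitary U \<Longrightarrow> (\<Sum>i\<in>UNIV. (cmod (U $ i $ j))\<^sup>2) = 1"
proof -
  assume "unitary U"
  then have "cinner (column j U) (column j U) = 1"
    by (simp add: unitary_iff_columns)
  then have "complex_of_real (\<Sum>i\<in>UNIV. (cmod (U $ i $ j))\<^sup>2) = 1"
    by (simp add: cinner_def column_def complex_norm_square mult.commute del: of_real_power)
  then show ?thesis
    using of_real_eq_1_iff by blast
qed

lemma unitary_row_sum: "unitary U \<Longrightarrow> (\<Sum>j\<in>UNIV. (cmod (U $ i $ j))\<^sup>2) = 1"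
  using unitary_column_sum[OF unitary_adj, of U i] by simp

text \<open>The weights are the squared overlaps of the two eigenbases. Even for operators that do
  not commute, the trace becomes a sum over pairs of eigenvalues, where scalar inequalities apply
  termwise.\<close>

lemma trace_mult_diagonalized:
  "trace ((V ** real_diag e ** adj V) ** (U ** real_diag d ** adj U))
    = complex_of_real (\<Sum>i\<in>UNIV. \<Sum>j\<in>UNIV. (cmod ((adj V ** U) $ i $ j))\<^sup>2 * (e i * d j))"
proof -
  define M where "M = adj V ** U"
  have "trace ((V ** real_diag e ** adj V) ** (U ** real_diag d ** adj U))
      = trace (V ** (real_diag e ** (adj V ** (U ** (real_diag d ** adj U)))))"
    by (simp add: matrix_mul_assoc)
  also have "\<dots> = trace ((real_diag e ** (adj V ** (U ** (real_diag d ** adj U)))) ** V)"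
    by (rule trace_mul_sym)
  also have "\<dots> = trace (real_diag e ** M ** real_diag d ** adj M)"
    by (simp add: M_def adj_mult matrix_mul_assoc)
  also have "\<dots> = (\<Sum>i\<in>UNIV. \<Sum>j\<in>UNIV. e i * M $ i $ j * d j * cnj (M $ i $ j))"
    by (simp only: trace_def matrix_mult_nth[of "real_diag e ** M ** real_diag d"]
        mult_real_diag_nth real_diag_mult_nth adj_nth)
  also have "\<dots> = (\<Sum>i\<in>UNIV. \<Sum>j\<in>UNIV. complex_of_real ((cmod (M $ i $ j))\<^sup>2 * (e i * d j)))"
    by (simp add: complex_norm_square mult_ac del: of_real_power)
  finally show ?thesis by (simp add: M_def)
qed

lemma mult_sgn_powr:
  fixes s p :: real
  assumes "1 < p"
  shows "s * (sgn s * \<bar>s\<bar> powr (p - 1)) = \<bar>s\<bar> powr p"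
  using assms powr_add[of "\<bar>s\<bar>" 1 "p - 1"] by (cases s "0::real" rule: linorder_cases) auto

text \<open>The tangent inequality at \<open>y\<close> of a convex function. Young's inequality with
  the conjugate exponents \<open>p\<close> and \<open>p / (p - 1)\<close> gives it without
  derivatives, hence also without a case split on signs beyond
  \<open>x * sgn y \<le> \<bar>x\<bar>\<close>.\<close>

lemma powr_tangent:
  fixes x y p :: real
  assumes p: "1 < p"
  shows "\<bar>y\<bar> powr p - \<bar>x\<bar> powr p \<le> p * ((y - x) * (sgn y * \<bar>y\<bar> powr (p - 1)))"
proof (cases "y = 0")
  case False
  define q where "q = p / (p - 1)"
  have q: "1 < q" "1 / p + 1 / q = 1" "p / q = p - 1"
    using p by (auto simp: q_def field_simps)
  have "\<bar>x\<bar> * \<bar>y\<bar> powr (p - 1) \<le> \<bar>x\<bar> powr p / p + (\<bar>y\<bar> powr (p - 1)) powr q / q"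
    by (rule Youngs_inequality) (use p q in auto)
  also have "(\<bar>y\<bar> powr (p - 1)) powr q = \<bar>y\<bar> powr p"
    using p by (simp add: powr_powr q_def)
  finally have "p * (\<bar>x\<bar> * \<bar>y\<bar> powr (p - 1)) \<le> p * (\<bar>x\<bar> powr p / p + \<bar>y\<bar> powr p / q)"
    using p by (intro mult_left_mono) auto
  also have "\<dots> = \<bar>x\<bar> powr p + p / q * \<bar>y\<bar> powr p"
    using p by (simp add: field_simps)
  finally have young: "p * (\<bar>x\<bar> * \<bar>y\<bar> powr (p - 1)) \<le> \<bar>x\<bar> powr p + (p - 1) * \<bar>y\<bar> powr p"
    by (simp add: q)
  have "x * (sgn y * \<bar>y\<bar> powr (p - 1)) \<le> \<bar>x\<bar> * \<bar>y\<bar> powr (p - 1)"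
  proof -
    have "x * sgn y \<le> \<bar>x\<bar>" by (cases y "0::real" rule: linorder_cases) auto
    from mult_right_mono[OF this, of "\<bar>y\<bar> powr (p - 1)"] show ?thesis by (simp add: mult.assoc)
  qed
  then have "p * (x * (sgn y * \<bar>y\<bar> powr (p - 1))) \<le> p * (\<bar>x\<bar> * \<bar>y\<bar> powr (p - 1))"
    using p by simp
  with young mult_sgn_powr[OF p, of y] show ?thesis
    by (simp add: algebra_simps)
qed (use p in simp)

text \<open>The p-th power of the Schatten p-norm, written as a pairing with its gradient up to the
  factor \<open>p\<close>; in this form its continuity follows from that of
  \<open>signed_power\<close>.\<close>

definition schatten_pow :: "real \<Rightarrow> 'n::finite op \<Rightarrow> real" where
  "schatten_pow p X = Re (trace (X ** signed_power p X))"

lemma schatten_pow_eq: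
  assumes U: "unitary U" and X: "X = U ** real_diag d ** adj U" and p: "1 < p"
  shows "schatten_pow p X = (\<Sum>i\<in>UNIV. \<bar>d i\<bar> powr p)"
proof -
  have "schatten_pow p X = (\<Sum>i\<in>UNIV. \<Sum>j\<in>UNIV. (cmod ((mat 1 :: 'a op) $ i $ j))\<^sup>2
      * (d i * (sgn (d j) * \<bar>d j\<bar> powr (p - 1))))"
    unfolding schatten_pow_def signed_power_def fun_calc_eq[OF U X]
    unfolding X trace_mult_diagonalized unitary_cancel[OF U] by simp
  also have "\<dots> = (\<Sum>i\<in>UNIV. d i * (sgn (d i) * \<bar>d i\<bar> powr (p - 1)))"
    by (intro sum.cong refl, subst sum.remove[of _ x for x])
      (auto simp: mat_def intro!: sum.neutral)
  finally show ?thesis by (simp add: mult_sgn_powr[OF p])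
qed

text \<open>The matrix of squared overlaps of the eigenbases is doubly stochastic, so both sides are
  averages over pairs of eigenvalues and the inequality reduces to \<open>powr_tangent\<close> for
  each pair.\<close>

lemma klein_schatten_pow:
  fixes X Y :: "'n::finite op"
  assumes "hermitian X" "hermitian Y" and p: "1 < p"
  shows "schatten_pow p Y - schatten_pow p X \<le> p * Re (trace ((Y - X) ** signed_power p Y))"
proof -
  obtain U d where U: "unitary U" and X: "X = U ** real_diag d ** adj U"
    using hermitian_diagonalization[OF assms(1)] by blast
  obtain V e where V: "unitary V" and Y: "Y = V ** real_diag e ** adj V"
    using hermitian_diagonalization[OF assms(2)] by blast
  define m where "m = (\<lambda>i j. (cmod ((adj V ** U) $ i $ j))\<^sup>2)"
  define g where "g = (\<lambda>s::real. sgn s * \<bar>s\<bar> powr (p - 1))"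
  have M: "unitary (adj V ** U)"
    by (intro unitary_mult unitary_adj U V)
  have m: "(\<Sum>i\<in>UNIV. m i j) = 1" "(\<Sum>j\<in>UNIV. m i j) = 1" for i j
    using unitary_column_sum[OF M] unitary_row_sum[OF M] by (simp_all add: m_def)
  have spY: "signed_power p Y = V ** real_diag (\<lambda>i. g (e i)) ** adj V"
    unfolding signed_power_def g_def by (rule fun_calc_eq[OF V Y])
  \<comment> \<open>Unit column sums here, and unit row sums for \<open>Y\<close> below, spread both
    single sums over the same pairs of indices.\<close>
  have "schatten_pow p X = (\<Sum>j\<in>UNIV. (\<Sum>i\<in>UNIV. m i j) * \<bar>d j\<bar> powr p)"
    by (simp add: schatten_pow_eq[OF U X p] m)
  also have "\<dots> = (\<Sum>i\<in>UNIV. \<Sum>j\<in>UNIV. m i j * \<bar>d j\<bar> powr p)"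
    unfolding sum_distrib_right by (rule sum.swap)
  finally have sX: "schatten_pow p X = \<dots>" .
  have "schatten_pow p Y = (\<Sum>i\<in>UNIV. (\<Sum>j\<in>UNIV. m i j) * \<bar>e i\<bar> powr p)"
    by (simp add: schatten_pow_eq[OF V Y p] m)
  also have "\<dots> = (\<Sum>i\<in>UNIV. \<Sum>j\<in>UNIV. m i j * \<bar>e i\<bar> powr p)"
    unfolding sum_distrib_right ..
  finally have sY: "schatten_pow p Y = \<dots>" .
  have eg: "e i * g (e i) = \<bar>e i\<bar> powr p" for i
    unfolding g_def by (rule mult_sgn_powr[OF p])
  have "Re (trace (Y ** signed_power p Y)) = (\<Sum>i\<in>UNIV. \<Sum>j\<in>UNIV. m i j * (e i * g (e i)))"
    using sY by (simp add: schatten_pow_def eg)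
  moreover have "Re (trace (X ** signed_power p Y)) = (\<Sum>i\<in>UNIV. \<Sum>j\<in>UNIV. m i j * (g (e i) * d j))"
    unfolding trace_mul_sym[of X] by (simp add: spY X trace_mult_diagonalized m_def)
  ultimately have "Re (trace ((Y - X) ** signed_power p Y))
      = (\<Sum>i\<in>UNIV. \<Sum>j\<in>UNIV. m i j * ((e i - d j) * g (e i)))"
    by (simp add: bounded_bilinear.diff_left[OF bounded_bilinear_matrix_mult] trace_sub
        sum_subtractf[symmetric] algebra_simps)
  moreover have "m i j * (\<bar>e i\<bar> powr p - \<bar>d j\<bar> powr p) \<le> p * (m i j * ((e i - d j) * g (e i)))" for i j
    using mult_left_mono[OF powr_tangent[OF p, of "e i" "d j"], of "m i j"]
    by (simp add: m_def g_def algebra_simps)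
  ultimately show ?thesis
    by (simp add: sX sY sum_subtractf[symmetric] right_diff_distrib[symmetric] sum_distrib_left sum_mono
        del: sum_subtractf)
qed

lemma schatten_pow_nonneg:
  assumes "hermitian X" "1 < p"
  shows "0 \<le> schatten_pow p X"
proof -
  obtain U d where "unitary U" "X = U ** real_diag d ** adj U"
    using hermitian_diagonalization[OF assms(1)] by blast
  then show ?thesis
    by (simp add: schatten_pow_eq[OF _ _ assms(2)] sum_nonneg)
qed

lemma schatten_pow_eq_0D:
  fixes X :: "'n::finite op"
  assumes "hermitian X" "1 < p" "schatten_pow p X = 0"
  shows "X = 0"
proof -
  obtain U d where U: "unitary U" "X = U ** real_diag d ** adj U"
    using hermitian_diagonalization[OF assms(1)] by blast
  then have "d i = 0" for i
    using assms(3) unfolding schatten_pow_eq[OF U assms(2)] by (simp add: sum_nonneg_eq_0_iff)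
  then have "real_diag d = (0 :: 'n op)"
    by (simp add: real_diag_def vec_eq_iff)
  then show ?thesis
    using U by (simp add: bounded_bilinear.zero_left[OF bounded_bilinear_matrix_mult]
        bounded_bilinear.zero_right[OF bounded_bilinear_matrix_mult])
qed

text \<open>Eigenvectors need not depend continuously on the operator, so no diagonalisation is
  followed along \<open>X\<close>. Instead the graph is cut out of the continuous image of a compact
  set of pairs of a unitary and an eigenvalue vector; a closed graph with values in a compact set
  forces continuity. The norm bound is what makes the eigenvalue vectors range over a compact
  box.\<close>

lemma continuous_on_fun_calc:
  fixes f :: "real \<Rightarrow> real"
  assumes f: "continuous_on UNIV f"
  shows "continuous_on {X :: 'n::finite op. hermitian X \<and> norm X \<le> R} (fun_calc f)"
proof -
  define S where "S = {X :: 'n op. hermitian X \<and> norm X \<le> R}"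
  have S: "S = {X. adj X = X} \<inter> cball 0 R"
    by (auto simp: S_def hermitian_def)
  have "compact S"
    unfolding S by (intro closed_Int_compact closed_Collect_eq continuous_intros compact_cball)
  \<comment> \<open>Eigenvalues are entries of a diagonal conjugate of \<open>X\<close>, so one
    bound on all conjugates bounds them all.\<close>
  have "bounded ((\<lambda>(U, X). adj U ** X ** U) ` ({U. unitary U} \<times> S))"
    unfolding case_prod_unfold
    by (intro compact_imp_bounded compact_continuous_image compact_Times compact_unitary
        \<open>compact S\<close> continuous_intros)
  then obtain B where B: "\<And>U X. unitary U \<Longrightarrow> X \<in> S \<Longrightarrow> norm (adj U ** X ** U) \<le> B"
    by (auto simp: bounded_iff)
  define D where "D = {U :: 'n op. unitary U} \<times> {d :: real^'n. \<forall>i. d $ i \<in> {-B..B}}"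
  have "compact D"
  proof -
    have "{d :: real^'n. \<forall>i. d $ i \<in> {-B..B}} = cbox (vec (-B)) (vec B)"
      by (auto simp: mem_box_cart)
    then show ?thesis
      unfolding D_def by (simp add: compact_Times compact_unitary compact_cbox)
  qed
  define \<Phi> where "\<Phi> = (\<lambda>h (U, d :: real^'n). U ** real_diag (\<lambda>i. h (d $ i)) ** adj U)"
  have \<Phi>: "continuous_on D (\<Phi> h)" if h: "continuous_on UNIV h" for h
  proof -
    have "continuous_on D (\<lambda>x. h (snd x $ i))" for i
      by (rule continuous_on_compose2[OF h]) (auto intro!: continuous_intros)
    then have "continuous_on D (\<lambda>x. real_diag (\<lambda>i. h (snd x $ i)))"
      unfolding real_diag_def
      by (intro continuous_on_vec_lambda, rename_tac i j, case_tac "i = j")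
        (auto intro!: continuous_intros)
    then show ?thesis
      unfolding \<Phi>_def case_prod_unfold by (intro continuous_intros)
  qed
  have fc: "fun_calc f (\<Phi> id x) = \<Phi> f x" if "x \<in> D" for x
    using that by (cases x) (simp add: D_def \<Phi>_def fun_calc_eq)
  have ex: "\<exists>x\<in>D. X = \<Phi> id x" if X: "X \<in> S" for X
  proof -
    obtain U d where U: "unitary U" "X = U ** real_diag d ** adj U"
      using hermitian_diagonalization X unfolding S_def by blast
    have "\<bar>d i\<bar> \<le> B" for i
    proof -
      have "adj U ** X ** U = real_diag d"
        by (simp add: U(2) matrix_mul_assoc[symmetric] unitary_cancel[OF U(1)])
      then have "norm (real_diag d :: 'n op) \<le> B"
        using B[OF U(1) X] by simp
      moreover have "cmod ((real_diag d :: 'n op) $ i $ i) \<le> norm (real_diag d :: 'n op)"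
        by (meson Finite_Cartesian_Product.norm_nth_le order_trans)
      ultimately show ?thesis by (simp add: real_diag_def)
    qed
    then have "(U, \<chi> i. d i) \<in> D"
      using U(1) by (auto simp: D_def abs_le_iff minus_le_iff)
    then show ?thesis
      using U(2) by (intro bexI) (auto simp: \<Phi>_def vec_lambda_inverse)
  qed
  have "compact (\<Phi> f ` D)"
    by (rule compact_continuous_image[OF \<Phi>[OF f] \<open>compact D\<close>])
  moreover have "fun_calc f \<in> S \<rightarrow> \<Phi> f ` D"
    using ex fc by fastforce
  \<comment> \<open>The box \<open>D\<close> also parametrises operators of norm above
    \<open>R\<close>; intersecting with \<open>S\<close> in the first coordinate discards
    them.\<close>
  moreover have "(\<lambda>X. (X, fun_calc f X)) ` S = (S \<times> UNIV) \<inter> (\<lambda>x. (\<Phi> id x, \<Phi> f x)) ` D"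
    using ex fc by fastforce
  moreover have "closed ((S \<times> UNIV) \<inter> (\<lambda>x. (\<Phi> id x, \<Phi> f x)) ` D)"
  proof (intro closed_Int closed_Times closed_UNIV)
    show "closed S"
      using \<open>compact S\<close> by (rule compact_imp_closed)
    have "continuous_on UNIV (id :: real \<Rightarrow> real)"
      by (simp add: continuous_on_id')
    then show "closed ((\<lambda>x. (\<Phi> id x, \<Phi> f x)) ` D)"
      by (intro compact_imp_closed compact_continuous_image continuous_on_Pair \<Phi> f \<open>compact D\<close>)
  qed
  ultimately show ?thesis
    unfolding S_def[symmetric] by (intro continuous_from_closed_graph) auto
qed

lemma continuous_on_signed_power:
  assumes "1 < p"
  shows "continuous_on {X :: 'n::finite op. hermitian X \<and> norm X \<le> R} (signed_power p)"
  unfolding signed_power_def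
proof (rule continuous_on_fun_calc)
  \<comment> \<open>Powers of the positive and negative parts replace the discontinuous
    \<open>sgn\<close>; the exponent is positive, so each is continuous at 0 as well.\<close>
  have "sgn s * \<bar>s\<bar> powr (p - 1) = max s 0 powr (p - 1) - max (- s) 0 powr (p - 1)" for s :: real
    by (cases s "0::real" rule: linorder_cases) auto
  then show "continuous_on UNIV (\<lambda>s::real. sgn s * \<bar>s\<bar> powr (p - 1))"
    using assms by (auto intro!: continuous_intros continuous_on_powr')
qed

section \<open>Compactness of the state space\<close>

lemma states_hermitian: "\<rho> \<in> states \<Longrightarrow> hermitian \<rho>"
  by (simp add: states_def positive_op_def)

text \<open>Boundedness comes from the spectrum: eigenvalues of a state are nonnegative with sum 1,
  and entries of a unitary have modulus at most 1, which bounds each entry of the state by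
  1.\<close>

lemma compact_states: "compact (states :: 'n::finite op set)"
proof -
  have "states = {\<rho> :: 'n op. adj \<rho> = \<rho>} \<inter> (\<Inter>v. {\<rho>. 0 \<le> Re (cinner v (\<rho> *v v))}) \<inter> {\<rho>. trace \<rho> = 1}"
    by (auto simp: states_def positive_op_def hermitian_def)
  moreover have "closed \<dots>"
    by (intro closed_Int closed_INT ballI closed_Collect_eq closed_Collect_le continuous_intros)
  moreover have "bounded (states :: 'n op set)"
  proof (rule bounded_entries)
    fix \<rho> :: "'n op" and i j
    assume \<rho>: "\<rho> \<in> states"
    obtain U d where U: "unitary U" "\<rho> = U ** real_diag d ** adj U"
      using hermitian_diagonalization states_hermitian[OF \<rho>] by blast
    have diag: "adj U ** \<rho> ** U = real_diag d"
      by (simp add: U(2) matrix_mul_assoc[symmetric] unitary_cancel[OF U(1)])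
    have "0 \<le> d k" for k
    proof -
      have "complex_of_real (d k) = cinner (column k U) (\<rho> *v column k U)"
        unfolding adj_mult_mult_nth[symmetric] diag by (simp add: real_diag_def)
      then show ?thesis
        using \<rho> by (metis (no_types, lifting) Re_complex_of_real mem_Collect_eq positive_op_def states_def)
    qed
    moreover have "(\<Sum>k\<in>UNIV. d k) = 1"
    proof -
      have "trace \<rho> = trace (adj U ** (U ** real_diag d))"
        unfolding U(2) by (rule trace_mul_sym)
      then have "trace \<rho> = complex_of_real (\<Sum>k\<in>UNIV. d k)"
        by (simp add: unitary_cancel[OF U(1)] trace_def real_diag_def)
      then show ?thesis
        using \<rho> by (metis (mono_tags, lifting) mem_Collect_eq of_real_eq_1_iff states_def)
    qed
    moreover have "cmod (\<rho> $ i $ j) \<le> (\<Sum>k\<in>UNIV. 1 * \<bar>d k\<bar> * 1)"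
    proof -
      have "\<rho> $ i $ j = (\<Sum>k\<in>UNIV. U $ i $ k * d k * cnj (U $ j $ k))"
        by (simp add: U(2) matrix_mult_nth[of "U ** real_diag d"] mult_real_diag_nth)
      also have "cmod \<dots> \<le> (\<Sum>k\<in>UNIV. 1 * \<bar>d k\<bar> * 1)"
      proof (rule sum_norm_le)
        fix k
        have "cmod (U $ i $ k * d k * cnj (U $ j $ k)) = cmod (U $ i $ k) * \<bar>d k\<bar> * cmod (U $ j $ k)"
          by (simp add: norm_mult)
        also have "\<dots> \<le> 1 * \<bar>d k\<bar> * 1"
          by (intro mult_mono unitary_entry_bound[OF U(1)]) auto
        finally show "cmod (U $ i $ k * d k * cnj (U $ j $ k)) \<le> 1 * \<bar>d k\<bar> * 1" .
      qed
      finally show ?thesis .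
    qed
    ultimately show "cmod (\<rho> $ i $ j) \<le> 1"
      by simp
  qed
  ultimately show ?thesis
    by (simp add: compact_eq_bounded_closed)
qed

section \<open>Lindbladian semigroups preserve states\<close>

text \<open>The exponential of \<open>t\<close> times \<open>A\<close>, applied to \<open>x\<close>
  and summed in the space of vectors. A general Euclidean space is taken because the complex
  numbers, where traces live, occur besides operators.\<close>

definition flow :: "('a::euclidean_space \<Rightarrow> 'a) \<Rightarrow> real \<Rightarrow> 'a \<Rightarrow> 'a" where
  "flow A t x = (\<Sum>k. (t ^ k / fact k) *\<^sub>R (A ^^ k) x)"

lemma flow_sums:
  fixes A :: "'a::euclidean_space \<Rightarrow> 'a"
  assumes A: "bounded_linear A"
  shows "(\<lambda>k. (t ^ k / fact k) *\<^sub>R (A ^^ k) x) sums flow A t x"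
proof -
  obtain B where B: "0 \<le> B" "\<And>x. norm (A x) \<le> norm x * B"
    using bounded_linear.nonneg_bounded[OF A] by blast
  have pow: "norm ((A ^^ k) x) \<le> B ^ k * norm x" for k
  proof (induction k)
    case (Suc k)
    have "norm ((A ^^ Suc k) x) \<le> norm ((A ^^ k) x) * B"
      using B(2) by simp
    also have "\<dots> \<le> B ^ k * norm x * B"
      by (intro mult_right_mono Suc B)
    finally show ?case by (simp add: mult_ac)
  qed simp
  have "summable (\<lambda>k. (t ^ k / fact k) *\<^sub>R (A ^^ k) x)"
  proof (rule summable_comparison_test')
    show "summable (\<lambda>k. inverse (fact k) * (\<bar>t\<bar> * B) ^ k * norm x)"
      by (intro summable_mult2 summable_exp)
    show "norm ((t ^ k / fact k) *\<^sub>R (A ^^ k) x) \<le> inverse (fact k) * (\<bar>t\<bar> * B) ^ k * norm x" for k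
    proof -
      have "norm ((t ^ k / fact k) *\<^sub>R (A ^^ k) x) = \<bar>t\<bar> ^ k / fact k * norm ((A ^^ k) x)"
        by (simp add: power_abs)
      also have "\<dots> \<le> \<bar>t\<bar> ^ k / fact k * (B ^ k * norm x)"
        by (intro mult_left_mono pow) simp
      finally show ?thesis
        by (simp add: power_mult_distrib field_simps)
    qed
  qed
  then show ?thesis
    unfolding flow_def by (rule summable_sums)
qed

text \<open>An intertwining relation passes through every term of the exponential series. Taking
  \<open>f\<close> to be \<open>adj\<close>, \<open>trace\<close>, a complex multiple or
  \<open>A\<close> itself yields Hermiticity, conservation of trace, complex linearity and
  commutation with the generator.\<close>

lemma flow_commute:
  assumes A: "bounded_linear A" and B: "bounded_linear B" and f: "bounded_linear f"
    and comm: "\<And>x. f (A x) = B (f x)"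
  shows "f (flow A t x) = flow B t (f x)"
proof -
  have "f ((A ^^ k) x) = (B ^^ k) (f x)" for k
    by (induction k) (simp_all add: comm)
  then have "(\<lambda>k. (t ^ k / fact k) *\<^sub>R (B ^^ k) (f x)) sums f (flow A t x)"
    using bounded_linear.sums[OF f flow_sums[OF A, of t x]]
    by (simp add: linear_cmul[OF bounded_linear.linear[OF f]])
  then show ?thesis
    using flow_sums[OF B] sums_unique2 by blast
qed

lemma flow_0: "flow A 0 x = x"
proof -
  have "(\<Sum>k. (0 ^ k / fact k) *\<^sub>R (A ^^ k) x) = (\<Sum>k\<in>{0}. (0 ^ k / fact k) *\<^sub>R (A ^^ k) x)"
    by (rule suminf_finite) auto
  then show ?thesis
    by (simp add: flow_def)
qed

lemma flow_zero: "flow (\<lambda>_. 0) t x = x"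
proof -
  have "((\<lambda>_. 0) ^^ k) x = (if k = 0 then x else 0)" for k
    by (cases k) auto
  then have "(\<lambda>k. (t ^ k / fact k) *\<^sub>R ((\<lambda>_. 0) ^^ k) x) = (\<lambda>k. if k = 0 then x else 0)"
    by (auto simp: fun_eq_iff)
  then show ?thesis
    unfolding flow_def using sums_unique[OF sums_single[of 0 "\<lambda>_. x"]] by simp
qed

lemma flow_add:
  assumes A: "bounded_linear A"
  shows "flow A t (x + y) = flow A t x + flow A t y"
proof -
  have "(A ^^ k) (x + y) = (A ^^ k) x + (A ^^ k) y" for k
    by (induction k) (simp_all add: linear_add[OF bounded_linear.linear[OF A]])
  then have "(\<lambda>k. (t ^ k / fact k) *\<^sub>R (A ^^ k) (x + y)) sums (flow A t x + flow A t y)"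
    using sums_add[OF flow_sums[OF A, of t x] flow_sums[OF A, of t y]]
    by (simp add: scaleR_add_right)
  then show ?thesis
    using flow_sums[OF A] sums_unique2 by blast
qed

text \<open>Each coordinate of the flow is an everywhere convergent real power series in time, which
  may be differentiated termwise; the shift of coefficients amounts to replacing \<open>x\<close> by
  \<open>A x\<close>.\<close>

lemma flow_has_vector_derivative:
  fixes A :: "'a::euclidean_space \<Rightarrow> 'a"
  assumes A: "bounded_linear A"
  shows "((\<lambda>t. flow A t x) has_vector_derivative A (flow A t x)) (at t within S)"
proof -
  have "((\<lambda>t. flow A t x \<bullet> b) has_derivative (\<lambda>h. (h *\<^sub>R A (flow A t x)) \<bullet> b)) (at t)" for b
  proof -
    define c where "c = (\<lambda>k. ((A ^^ k) x \<bullet> b) / fact k)"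
    have c: "(\<lambda>k. c k * t ^ k) sums (flow A t x \<bullet> b)" for t
      using bounded_linear.sums[OF bounded_linear_inner_left flow_sums[OF A, of t x], of b]
      by (simp add: c_def mult_ac)
    have "((\<lambda>t. \<Sum>k. c k * t ^ k) has_field_derivative (\<Sum>k. diffs c k * t ^ k)) (at t)"
      by (intro termdiffs_strong_converges_everywhere sums_summable[OF c])
    moreover have "(\<lambda>t. \<Sum>k. c k * t ^ k) = (\<lambda>t. flow A t x \<bullet> b)"
      using c by (simp add: sums_iff)
    moreover have "(\<Sum>k. diffs c k * t ^ k) = A (flow A t x) \<bullet> b"
    proof -
      have "diffs c k = ((A ^^ k) (A x) \<bullet> b) / fact k" for k
        by (simp add: diffs_def c_def funpow_swap1 field_simps del: of_nat_Suc)
      then have "(\<lambda>k. diffs c k * t ^ k) sums (flow A t (A x) \<bullet> b)"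
        using bounded_linear.sums[OF bounded_linear_inner_left flow_sums[OF A, of t "A x"], of b]
        by (simp add: mult_ac)
      then show ?thesis
        by (simp add: sums_iff flow_commute[OF A A A, symmetric])
    qed
    ultimately have "((\<lambda>t. flow A t x \<bullet> b) has_derivative (*) (A (flow A t x) \<bullet> b)) (at t)"
      by (simp add: has_field_derivative_def)
    then show ?thesis
      by (simp add: mult.commute[of _ "_ \<bullet> _"])
  qed
  then have "((\<lambda>t. flow A t x) has_vector_derivative A (flow A t x)) (at t)"
    unfolding has_vector_derivative_def by (subst has_derivative_componentwise_within) simp
  then show ?thesis
    by (rule has_vector_derivative_at_within)
qed

lemma continuous_on_flow:
  fixes A :: "'a::euclidean_space \<Rightarrow> 'a"
  assumes "bounded_linear A"
  shows "continuous_on S (\<lambda>t. flow A t x)"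
  using flow_has_vector_derivative[OF assms]
  by (meson continuous_on_eq_continuous_within has_vector_derivative_continuous)

section \<open>Positivity along a flow\<close>

lemma positive_op_unitI:
  fixes X :: "'n::finite op"
  assumes "hermitian X" and unit: "\<And>v. norm v = 1 \<Longrightarrow> 0 \<le> Re (cinner v (X *v v))"
  shows "positive_op X"
  unfolding positive_op_def
proof (intro conjI allI assms(1))
  fix v :: "complex^'n"
  define u where "u = (1 / norm v) *\<^sub>R v"
  show "0 \<le> Re (cinner v (X *v v))"
  proof (cases "v = 0")
    case False
    then have "norm u = 1" "v = norm v *\<^sub>R u"
      by (simp_all add: u_def)
    then have "Re (cinner v (X *v v)) = (norm v)\<^sup>2 * Re (cinner u (X *v u))"
      by (metis (no_types, lifting) bounded_bilinear.scaleR_left[OF bounded_bilinear_cinner]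
          bounded_bilinear.scaleR_right[OF bounded_bilinear_cinner]
          bounded_bilinear.scaleR_right[OF bounded_bilinear_matrix_vector_mult]
          scaleR_complex.simps(1) power2_eq_square mult.assoc)
    then show ?thesis
      using unit[OF \<open>norm u = 1\<close>] by simp
  qed simp
qed

text \<open>A zero of a nonnegative form is a minimum. If \<open>R *v v\<close> were nonzero, moving
  from \<open>v\<close> a little against that direction would make the form negative.\<close>

lemma positive_op_kernel:
  fixes R :: "'n::finite op"
  assumes R: "positive_op R" and v: "Re (cinner v (R *v v)) = 0"
  shows "R *v v = 0"
proof (rule ccontr)
  assume nz: "R *v v \<noteq> 0"
  define w where "w = R *v v"
  define a where "a = Re (cinner w (R *v w))"
  define N where "N = (norm w)\<^sup>2"
  have a: "0 \<le> a" and N: "0 < N"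
    using R nz by (simp_all add: a_def N_def w_def positive_op_def)
  \<comment> \<open>Small enough for \<open>s * a \<ge> - N\<close>, so that
    \<open>2 * N + s * a\<close> stays positive although \<open>s\<close> is negative.\<close>
  define s where "s = - N / (a + 1)"
  have "cinner v (R *v w) = cinner (R *v v) w"
    using R by (metis cinner_adj hermitian_def positive_op_def)
  then have vw: "Re (cinner v (R *v w)) = N" "Re (cinner w (R *v v)) = N"
    by (simp_all add: w_def[symmetric] cinner_self N_def)
  have "0 \<le> Re (cinner (v + s *\<^sub>R w) (R *v (v + s *\<^sub>R w)))"
    using R by (simp add: positive_op_def)
  also have "\<dots> = s * (2 * N + s * a)"
    using v vw
    by (simp add: matrix_vector_right_distrib cinner_add_left cinner_add_right
        bounded_bilinear.scaleR_left[OF bounded_bilinear_cinner]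
        bounded_bilinear.scaleR_right[OF bounded_bilinear_cinner]
        bounded_bilinear.scaleR_right[OF bounded_bilinear_matrix_vector_mult]
        a_def[symmetric] algebra_simps)
  finally have "0 \<le> s * (2 * N + s * a)" .
  moreover have "s < 0"
    using a N by (simp add: s_def divide_neg_pos)
  moreover have "0 < 2 * N + s * a"
  proof -
    have "s * a = - N * (a / (a + 1))" by (simp add: s_def)
    moreover have "N * (a / (a + 1)) \<le> N * 1"
      using a N by (intro mult_left_mono) (auto simp: field_simps)
    ultimately show ?thesis using N by simp
  qed
  ultimately show False
    by (simp add: zero_le_mult_iff)
qed

text \<open>
  A positivity barrier: adding \<open>\<delta> e\<^sup>M\<^sup>t\<close> times the identity makes the expectation at a first zero
  strictly increasing, which is impossible since it was positive before.
\<close>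

lemma flow_positive_op:
  fixes A :: "'n::finite superop"
  assumes A: "bounded_linear A" and adjA: "\<And>X. adj (A X) = A (adj X)"
    and ker: "\<And>R v. positive_op R \<Longrightarrow> R *v v = 0 \<Longrightarrow> 0 \<le> Re (cinner v (A R *v v))"
    and \<rho>: "positive_op \<rho>" and t: "0 \<le> t"
  shows "positive_op (flow A t \<rho>)"
proof -
  define E :: "'n op \<Rightarrow> complex^'n \<Rightarrow> real" where "E = (\<lambda>X v. Re (cinner v (X *v v)))"
  have blE: "bounded_linear (\<lambda>X. E X v)" for v
    unfolding E_def
    by (intro bounded_linear_compose[OF bounded_linear_Re]
        bounded_linear_compose[OF bounded_bilinear.bounded_linear_right[OF bounded_bilinear_cinner]]
        bounded_bilinear.bounded_linear_left[OF bounded_bilinear_matrix_vector_mult])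
  have E_add: "E (X + Y) v = E X v + E Y v" and E_scale: "E (c *\<^sub>R X) v = c * E X v" for X Y c v
    using linear_add[OF bounded_linear.linear[OF blE]] linear_cmul[OF bounded_linear.linear[OF blE]]
    by auto
  have E_1: "E (mat 1) v = 1" if "norm v = 1" for v
    using that by (simp add: E_def cinner_self)
  have herm: "hermitian (flow A s \<rho>)" for s
    using flow_commute[OF A A bounded_linear_adj, of s \<rho>] adjA \<rho>
    by (simp add: hermitian_def positive_op_def)
  have "compact ((\<lambda>v. E (A (mat 1)) v) ` sphere 0 1)"
    unfolding E_def by (intro compact_continuous_image continuous_intros compact_sphere)
  then obtain B where B: "\<And>v. norm v = 1 \<Longrightarrow> \<bar>E (A (mat 1)) v\<bar> \<le> B"
    using compact_imp_bounded by (force simp: bounded_iff)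
  \<comment> \<open>Strictly larger than the form of \<open>A (mat 1)\<close> on the unit sphere:
    the barrier grows faster than the generator can erode it.\<close>
  define M where "M = B + 1"
  define R where "R = (\<lambda>\<delta> s. flow A s \<rho> + (\<delta> * exp (M * s)) *\<^sub>R mat 1)"
  have hermR: "hermitian (R \<delta> s)" for \<delta> s
  proof -
    have "adj (mat 1) = (mat 1 :: 'n op)"
      by (simp add: vec_eq_iff mat_def)
    then show ?thesis
      using herm[of s] by (simp add: R_def hermitian_def adj_add adj_scaleR)
  qed
  have pos: "0 < E (R \<delta> s) v" if \<delta>: "0 < \<delta>" and s: "0 \<le> s" and v: "norm v = 1" for \<delta> s v
  proof (rule ccontr)
    assume neg: "\<not> 0 < E (R \<delta> s) v"
    define Z where "Z = {z \<in> {0..s} \<times> sphere 0 1. E (R \<delta> (fst z)) (snd z) \<le> 0}"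
    have cont: "continuous_on X (\<lambda>z. flow A (fst z) \<rho>)" for X :: "(real \<times> (complex^'n)) set"
      by (rule continuous_on_compose2[OF continuous_on_flow[OF A, of UNIV]]) (auto intro: continuous_intros)
    have "Z = ({0..s} \<times> sphere 0 1) \<inter> {z. E (R \<delta> (fst z)) (snd z) \<le> 0}"
      by (auto simp: Z_def)
    moreover have "compact \<dots>"
      unfolding E_def R_def
      by (intro compact_Int_closed compact_Times compact_Icc compact_sphere closed_Collect_le
          continuous_intros cont)
    ultimately have "compact Z" by simp
    moreover have "(s, v) \<in> Z"
      using neg s v by (simp add: Z_def)
    \<comment> \<open>An earliest failure exists because the pairs of a time and a unit vector at
      which positivity fails form a compact set.\<close>
    ultimately obtain z where z: "z \<in> Z" "\<And>y. y \<in> Z \<Longrightarrow> fst z \<le> fst y"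
      using continuous_attains_inf[of Z fst] continuous_on_fst[OF continuous_on_id] by (metis empty_iff)
    obtain s0 v0 where z_eq: "z = (s0, v0)" by (cases z)
    have s0: "0 \<le> s0" "s0 \<le> s" and v0: "norm v0 = 1" and le0: "E (R \<delta> s0) v0 \<le> 0"
      using z(1) by (auto simp: Z_def z_eq)
    have before: "0 < E (R \<delta> s') v" if "0 \<le> s'" "s' < s0" "norm v = 1" for s' v
    proof (rule ccontr)
      assume "\<not> 0 < E (R \<delta> s') v"
      then have "(s', v) \<in> Z"
        using that s0 by (simp add: Z_def)
      then show False
        using z(2) that by (fastforce simp: z_eq)
    qed
    have "0 < E (R \<delta> 0) v0"
      using \<rho> \<delta> E_1[OF v0]
      by (simp add: R_def flow_0 E_add E_scale) (simp add: E_def positive_op_def add_nonneg_pos)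
    then have s0_pos: "0 < s0"
      using le0 s0 by (cases "s0 = 0") auto
    have cont_s: "continuous (at s0) (\<lambda>s. E (R \<delta> s) v)" for v
    proof -
      have "continuous_on UNIV (\<lambda>s. E (R \<delta> s) v)"
        unfolding E_def R_def by (intro continuous_intros continuous_on_flow A)
      then show ?thesis
        by (simp add: continuous_on_eq_continuous_at)
    qed
    have at: "0 \<le> E (R \<delta> s0) v" if "norm v = 1" for v
    proof (rule tendsto_lowerbound)
      show "((\<lambda>s. E (R \<delta> s) v) \<longlongrightarrow> E (R \<delta> s0) v) (at_left s0)"
        using cont_s by (simp add: continuous_at filterlim_at_split)
      show "\<forall>\<^sub>F s in at_left s0. 0 \<le> E (R \<delta> s) v"
        using eventually_at_left_real[OF s0_pos] by eventually_elim (auto intro!: less_imp_le before that)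
    qed simp
    have "positive_op (R \<delta> s0)"
      by (rule positive_op_unitI[OF hermR]) (use at in \<open>simp add: E_def\<close>)
    moreover have zero: "E (R \<delta> s0) v0 = 0"
      using le0 at[OF v0] by simp
    \<comment> \<open>The zero puts \<open>v0\<close> into the kernel of
      \<open>R \<delta> s0\<close>, so \<open>ker\<close> applies to the perturbed operator. Only
      the drift of the added identity has to be compensated, which \<open>M\<close> does.\<close>
    ultimately have "0 \<le> E (A (R \<delta> s0)) v0"
      using ker positive_op_kernel unfolding E_def by blast
    moreover have "E (A (R \<delta> s0)) v0
        = E (A (flow A s0 \<rho>)) v0 + \<delta> * exp (M * s0) * E (A (mat 1)) v0"
      by (simp add: R_def linear_add[OF bounded_linear.linear[OF A]]
          linear_cmul[OF bounded_linear.linear[OF A]] E_add E_scale)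
    moreover have "\<delta> * exp (M * s0) * E (A (mat 1)) v0 < \<delta> * exp (M * s0) * M"
      using B[OF v0] \<delta> by (intro mult_strict_left_mono) (auto simp: M_def)
    ultimately have slope: "0 < E (A (flow A s0 \<rho>)) v0 + \<delta> * exp (M * s0) * M"
      by simp
    have "((\<lambda>s. E (flow A s \<rho>) v0) has_real_derivative E (A (flow A s0 \<rho>)) v0) (at s0)"
      unfolding has_real_derivative_iff_has_vector_derivative
      by (rule bounded_linear.has_vector_derivative[OF blE flow_has_vector_derivative[OF A]])
    then have "((\<lambda>s. E (R \<delta> s) v0) has_real_derivative
        E (A (flow A s0 \<rho>)) v0 + \<delta> * exp (M * s0) * M) (at s0)"
      unfolding R_def E_add E_scale E_1[OF v0]
      by (auto intro!: derivative_eq_intros simp: mult_ac)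
    from DERIV_pos_inc_left[OF this slope] obtain d where
      "0 < d" "\<And>h. 0 < h \<Longrightarrow> h < d \<Longrightarrow> E (R \<delta> (s0 - h)) v0 < E (R \<delta> s0) v0"
      by blast
    from this(2)[of "min (d / 2) s0"] this(1) s0_pos
    have "E (R \<delta> (s0 - min (d / 2) s0)) v0 < 0"
      by (simp add: zero)
    moreover have "0 < E (R \<delta> (s0 - min (d / 2) s0)) v0"
      using \<open>0 < d\<close> s0_pos by (intro before v0) auto
    ultimately show False by simp
  qed
  show ?thesis
  proof (rule positive_op_unitI[OF herm])
    fix v :: "complex^'n" assume v: "norm v = 1"
    have "0 \<le> E (flow A t \<rho>) v"
    proof (rule field_le_epsilon)
      fix e :: real assume "0 < e"
      \<comment> \<open>With this choice of \<delta> the barrier term at time \<open>t\<close> is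
        exactly \<open>e\<close>.\<close>
      then show "0 \<le> E (flow A t \<rho>) v + e"
        using pos[of "e / exp (M * t)" t v] t v by (simp add: R_def E_add E_scale E_1)
    qed
    then show "0 \<le> Re (cinner v (flow A t \<rho> *v v))"
      by (simp add: E_def)
  qed
qed

section \<open>Algebra of the Lindblad form\<close>

lemmas matrix_mult_distribs =
  bounded_bilinear.add_left[OF bounded_bilinear_matrix_mult]
  bounded_bilinear.add_right[OF bounded_bilinear_matrix_mult]
  bounded_bilinear.scaleR_left[OF bounded_bilinear_matrix_mult]
  bounded_bilinear.scaleR_right[OF bounded_bilinear_matrix_mult]

lemma csmult_mult_left: "csmult c A ** B = csmult c (A ** B)"
  and csmult_mult_right: "A ** csmult c B = csmult c (A ** B)"
  by (simp_all add: vec_eq_iff matrix_mult_nth sum_distrib_left mult_ac)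

lemma csmult_add: "csmult c (A + B) = csmult c A + csmult c B"
  and csmult_diff: "csmult c (A - B) = csmult c A - csmult c B"
  and csmult_scaleR: "csmult c (r *\<^sub>R A) = r *\<^sub>R csmult c A"
  and csmult_csmult: "csmult c (csmult d A) = csmult (c * d) A"
  by (simp_all add: vec_eq_iff algebra_simps)

lemma csmult_sum: "csmult c (\<Sum>i\<in>I. A i) = (\<Sum>i\<in>I. csmult c (A i))"
  by (simp add: vec_eq_iff sum_distrib_left)

lemma bounded_linear_csmult: "bounded_linear (csmult c :: 'n::finite op \<Rightarrow> 'n op)"
  by (intro linear_conv_bounded_linear[THEN iffD1] linearI) (simp_all add: csmult_add csmult_scaleR)

lemma lindblad_form_add: "lindblad_form H n V (X + Y) = lindblad_form H n V X + lindblad_form H n V Y"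
  by (simp add: lindblad_form_def matrix_mult_distribs csmult_add csmult_diff sum.distrib
      sum_subtractf algebra_simps scaleR_add_right)

lemma lindblad_form_csmult: "lindblad_form H n V (csmult c X) = csmult c (lindblad_form H n V X)"
  by (simp add: lindblad_form_def csmult_mult_left csmult_mult_right csmult_add csmult_diff
      csmult_sum csmult_scaleR csmult_csmult mult.commute)

lemma lindblad_form_adj:
  assumes "hermitian H"
  shows "adj (lindblad_form H n V X) = lindblad_form H n V (adj X)"
proof -
  have "adj (csmult (- \<i>) (H ** X - X ** H)) = csmult (- \<i>) (H ** adj X - adj X ** H)"
  proof -
    have "adj (csmult (- \<i>) (H ** X - X ** H)) = csmult \<i> (adj X ** H - H ** adj X)"
      using assms by (simp add: adj_csmult adj_diff adj_mult hermitian_def)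
    then show ?thesis
      by (simp add: vec_eq_iff algebra_simps)
  qed
  moreover have "adj (V j ** X ** adj (V j) - (1/2) *\<^sub>R (adj (V j) ** V j ** X + X ** (adj (V j) ** V j)))
      = V j ** adj X ** adj (V j)
        - (1/2) *\<^sub>R (adj (V j) ** V j ** adj X + adj X ** (adj (V j) ** V j))" for j
    by (simp add: adj_diff adj_scaleR adj_add adj_mult matrix_mul_assoc add.commute)
  ultimately show ?thesis
    by (simp only: lindblad_form_def adj_add adj_sum)
qed

lemma lindblad_form_trace: "trace (lindblad_form H n V X) = 0"
proof -
  have tr_scaleR: "trace (r *\<^sub>R Y) = r *\<^sub>R trace Y" for r and Y :: "'a op"
    by (rule linear_cmul[OF bounded_linear.linear[OF bounded_linear_trace]])
  have "trace (csmult (- \<i>) (H ** X - X ** H)) = - \<i> * trace (H ** X - X ** H)"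
    by (simp add: trace_def sum_distrib_left)
  moreover have "trace (H ** X) = trace (X ** H)"
    by (rule trace_mul_sym)
  moreover have "trace (V j ** X ** adj (V j)
      - (1/2) *\<^sub>R (adj (V j) ** V j ** X + X ** (adj (V j) ** V j))) = 0" for j
  proof -
    have "trace (V j ** X ** adj (V j)) = trace (adj (V j) ** V j ** X)"
      using trace_mul_sym[of "V j ** X" "adj (V j)"] by (simp add: matrix_mul_assoc)
    moreover have "trace (X ** (adj (V j) ** V j)) = trace (adj (V j) ** V j ** X)"
      by (rule trace_mul_sym)
    ultimately show ?thesis
      by (simp add: trace_sub trace_add tr_scaleR scaleR_2[symmetric])
  qed
  ultimately show ?thesis
    by (simp add: lindblad_form_def trace_add trace_sub
        linear_sum[OF bounded_linear.linear[OF bounded_linear_trace]])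
qed

text \<open>Since \<open>R\<close> is Hermitian and kills \<open>v\<close>, every term with
  \<open>R\<close> outermost on either side drops out of the form at \<open>v\<close>. Only the jump
  terms survive, and these are values of the form of \<open>R\<close>. This is the kernel condition
  that the positivity barrier needs.\<close>

lemma lindblad_form_kernel_nonneg:
  assumes H: "hermitian H" and R: "positive_op R" and v: "R *v v = 0"
  shows "0 \<le> Re (cinner v (lindblad_form H n V R *v v))"
proof -
  have csm: "csmult c Y *v v = c *s (Y *v v)" for c Y
    by (simp add: vec_eq_iff matrix_vector_mult_def sum_distrib_left mult.assoc)
  have Rv: "cinner v (R *v w) = 0" for w
    using R v by (simp add: cinner_adj positive_op_def hermitian_def)
  have jump: "cinner v ((V j ** R ** adj (V j)
      - (1/2) *\<^sub>R (adj (V j) ** V j ** R + R ** (adj (V j) ** V j))) *v v)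
      = cinner (adj (V j) *v v) (R *v (adj (V j) *v v))" for j
  proof -
    have "cinner v ((V j ** R ** adj (V j)) *v v) = cinner (adj (V j) *v v) (R *v (adj (V j) *v v))"
      by (simp add: matrix_vector_mul_assoc[symmetric] cinner_adj[of v "V j"])
    moreover have "(adj (V j) ** V j ** R) *v v = 0"
      by (simp add: matrix_vector_mul_assoc[symmetric] v)
    moreover have "cinner v ((R ** (adj (V j) ** V j)) *v v) = 0"
      by (simp add: matrix_vector_mul_assoc[symmetric] Rv)
    ultimately show ?thesis
      by (simp add: matrix_vector_mult_diff_rdistrib matrix_vector_mult_add_rdistrib
          bounded_bilinear.scaleR_left[OF bounded_bilinear_matrix_vector_mult]
          bounded_bilinear.diff_right[OF bounded_bilinear_cinner]
          bounded_bilinear.scaleR_right[OF bounded_bilinear_cinner])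
  qed
  have "cinner v (csmult (- \<i>) (H ** R - R ** H) *v v) = 0"
    by (simp add: csm cinner_smult_right matrix_vector_mult_diff_rdistrib
        bounded_bilinear.diff_right[OF bounded_bilinear_cinner]
        matrix_vector_mul_assoc[symmetric] v Rv)
  then have "cinner v (lindblad_form H n V R *v v)
      = (\<Sum>j = 1..n. cinner (adj (V j) *v v) (R *v (adj (V j) *v v)))"
    by (simp add: lindblad_form_def matrix_vector_mult_add_rdistrib cinner_add_right jump
        bounded_bilinear.sum_left[OF bounded_bilinear_matrix_vector_mult]
        bounded_bilinear.sum_right[OF bounded_bilinear_cinner])
  then show ?thesis
    using R by (simp add: positive_op_def sum_nonneg)
qed

lemma lindbladian_bounded_linear:
  assumes "A \<in> lindbladians"
  shows "bounded_linear A"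
proof -
  obtain H n V where A: "A = lindblad_form H n V"
    using assms by (auto simp: lindbladians_def)
  have "csmult (complex_of_real r) X = r *\<^sub>R X" for r and X :: "'a op"
    by (simp add: vec_eq_iff) (simp add: scaleR_conv_of_real)
  then have "linear A"
    using lindblad_form_csmult[of H n V "complex_of_real _"]
    by (intro linearI) (simp_all add: A lindblad_form_add)
  then show ?thesis
    by (simp add: linear_conv_bounded_linear)
qed

lemma lindbladian_flow_states:
  assumes "A \<in> lindbladians" "\<rho> \<in> states" "0 \<le> t"
  shows "flow A t \<rho> \<in> states"
proof -
  obtain H n V where A: "A = lindblad_form H n V" and H: "hermitian H"
    using assms(1) by (auto simp: lindbladians_def)
  note bl = lindbladian_bounded_linear[OF assms(1)]
  have "positive_op (flow A t \<rho>)"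
    using assms(2,3) H bl
    by (intro flow_positive_op) (auto simp: A lindblad_form_adj lindblad_form_kernel_nonneg states_def)
  \<comment> \<open>The trace intertwines the generator with the zero map, whose flow is
    constant.\<close>
  moreover have "trace (flow A t \<rho>) = flow (\<lambda>_. 0) t (trace \<rho>)"
    using lindblad_form_trace
    by (intro flow_commute bl bounded_linear_trace bounded_linear_zero) (simp add: A)
  ultimately show ?thesis
    using assms(2) by (simp add: states_def flow_zero)
qed

lemma lindbladian_flow_csmult:
  assumes "A \<in> lindbladians"
  shows "flow A t (csmult c X) = csmult c (flow A t X)"
proof -
  note bl = lindbladian_bounded_linear[OF assms]
  have "csmult c (A Y) = A (csmult c Y)" for Y
    using assms by (auto simp: lindbladians_def lindblad_form_csmult)
  then show ?thesis
    using flow_commute[OF bl bl bounded_linear_csmult] by metis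
qed

section \<open>Control by piecewise constant generators\<close>

text \<open>An initial piece of a controlled evolution. The functions are total, but only their
  values on \<open>{0..duration}\<close> carry meaning, so pieces are compared by
  \<open>agree_on\<close> and never by equality.\<close>

datatype 'n plan = Plan (duration: real) (evol: "real \<Rightarrow> 'n::finite superop") (gen: "real \<Rightarrow> 'n superop")

definition plan_of :: "'n::finite superop set \<Rightarrow> 'n plan \<Rightarrow> bool" where
  "plan_of K c \<longleftrightarrow> 0 \<le> duration c \<and> evol c 0 = id \<and>
     (\<forall>t\<in>{0..duration c}. gen c t \<in> K \<and> Vector_Spaces.linear csmult csmult (evol c t)) \<and>
     (\<forall>x. \<forall>t\<in>{0..duration c}. set_integrable lborel {0..t} (\<lambda>s. gen c s (evol c s x)) \<and>
        evol c t x = x + (LINT s:{0..t}|lborel. gen c s (evol c s x)))"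

abbreviation endpoint :: "'n::finite op \<Rightarrow> 'n plan \<Rightarrow> 'n op" where
  "endpoint \<rho> c \<equiv> evol c (duration c) \<rho>"

definition agree_on :: "real \<Rightarrow> 'n::finite plan \<Rightarrow> 'n plan \<Rightarrow> bool" where
  "agree_on \<tau> c c' \<longleftrightarrow> (\<forall>t\<in>{0..\<tau>}. evol c' t = evol c t \<and> gen c' t = gen c t)"

text \<open>Agreement concerns the whole superoperators, as needed for gluing, while confinement to
  \<open>S\<close> concerns the orbit of \<rho> alone. The junction time is included, so
  \<open>S\<close> must already contain the endpoint of \<open>c\<close>.\<close>

definition extends :: "'n::finite superop set \<Rightarrow> 'n op \<Rightarrow> 'n op set \<Rightarrow> 'n plan \<Rightarrow> 'n plan \<Rightarrow> bool" where
  "extends K \<rho> S c c' \<longleftrightarrow> plan_of K c' \<and> duration c \<le> duration c' \<and> agree_on (duration c) c c' \<and>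
     (\<forall>t\<in>{duration c..duration c'}. evol c' t \<rho> \<in> S)"

lemma extends_refl:
  "plan_of K c \<Longrightarrow> endpoint \<rho> c \<in> S \<Longrightarrow> extends K \<rho> S c c"
  by (auto simp: extends_def agree_on_def)

lemma extends_trans:
  assumes "plan_of K c" "extends K \<rho> S c c'" "extends K \<rho> S c' c''"
  shows "extends K \<rho> S c c''"
proof -
  have "evol c'' t \<rho> \<in> S" if "t \<in> {duration c..duration c''}" for t
  proof (cases "t \<le> duration c'")
    case True
    then have "evol c'' t = evol c' t"
      using that assms by (auto simp: extends_def agree_on_def plan_of_def)
    then show ?thesis
      using that True assms by (auto simp: extends_def)
  qed (use that assms in \<open>auto simp: extends_def\<close>)
  then show ?thesis
    using assms by (auto simp: extends_def agree_on_def)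
qed

lemma extends_endpoint: "extends K \<rho> S c c' \<Longrightarrow> endpoint \<rho> c' \<in> S"
  and extends_plan_of: "extends K \<rho> S c c' \<Longrightarrow> plan_of K c'"
  and extends_duration: "extends K \<rho> S c c' \<Longrightarrow> duration c \<le> duration c'"
  by (simp_all add: extends_def)

lemma vector_space_csmult: "vector_space (csmult :: complex \<Rightarrow> 'n::finite op \<Rightarrow> 'n op)"
  by unfold_locales (simp_all add: vec_eq_iff algebra_simps)

lemma lindbladian_flow_linear:
  "A \<in> lindbladians \<Longrightarrow> Vector_Spaces.linear csmult csmult (flow A t)"
  by (simp add: Vector_Spaces.linear_iff vector_space_csmult flow_add lindbladian_bounded_linear
      lindbladian_flow_csmult)

text \<open>The exponential of \<open>A\<close> is composed with the last recorded superoperator.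
  Past the junction, the integral equation is the old one at the junction plus the fundamental
  theorem of calculus on the new piece.\<close>

lemma extends_flow:
  fixes c :: "'n::finite plan"
  assumes c: "plan_of K c" and A: "A \<in> K" "A \<in> lindbladians" and h: "0 \<le> h"
    and S: "\<And>t. t \<in> {0..h} \<Longrightarrow> flow A t (endpoint \<rho> c) \<in> S"
  shows "\<exists>c'. extends K \<rho> S c c' \<and> duration c' = duration c + h \<and> endpoint \<rho> c' = flow A h (endpoint \<rho> c)"
proof -
  define \<tau> where "\<tau> = duration c"
  define T where "T = (\<lambda>t. if t \<le> \<tau> then evol c t else flow A (t - \<tau>) \<circ> evol c \<tau>)"
  define L where "L = (\<lambda>t. if t \<le> \<tau> then gen c t else A)"
  note bl = lindbladian_bounded_linear[OF A(2)]
  have \<tau>: "0 \<le> \<tau>"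
    using c by (simp add: \<tau>_def plan_of_def)
  have T_after: "T t = flow A (t - \<tau>) \<circ> evol c \<tau>" if "\<tau> \<le> t" for t
    using that by (auto simp: T_def flow_0 fun_eq_iff)
  have old: "set_integrable lborel {0..t} (\<lambda>s. L s (T s x)) \<and>
      T t x = x + (LINT s:{0..t}|lborel. L s (T s x))" if t: "0 \<le> t" "t \<le> \<tau>" for t x
  proof -
    have eq: "L s (T s x) = gen c s (evol c s x)" if "s \<in> {0..t}" for s
      using that t by (simp add: L_def T_def)
    have "set_integrable lborel {0..t} (\<lambda>s. gen c s (evol c s x))"
      "evol c t x = x + (LINT s:{0..t}|lborel. gen c s (evol c s x))"
      using c t by (auto simp: plan_of_def \<tau>_def)
    moreover have "set_integrable lborel {0..t} (\<lambda>s. L s (T s x))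
        = set_integrable lborel {0..t} (\<lambda>s. gen c s (evol c s x))"
      by (intro set_integrable_cong refl eq)
    moreover have "(LINT s:{0..t}|lborel. L s (T s x)) = (LINT s:{0..t}|lborel. gen c s (evol c s x))"
      by (intro set_lebesgue_integral_cong) (auto simp: eq)
    ultimately show ?thesis
      using t by (simp add: T_def)
  qed
  have new: "set_integrable lborel {0..t} (\<lambda>s. L s (T s x)) \<and>
      T t x = x + (LINT s:{0..t}|lborel. L s (T s x))" if t: "\<tau> < t" for t x
  proof -
    define g where "g = (\<lambda>s. flow A (s - \<tau>) (evol c \<tau> x))"
    have deriv: "(g has_vector_derivative A (g s)) (at s within {\<tau>..t})" for s
    proof -
      have "((\<lambda>s. s - \<tau>) has_vector_derivative 1) (at s within {\<tau>..t})"
        by (auto intro!: derivative_eq_intros)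
      from vector_diff_chain_within[OF this flow_has_vector_derivative[OF bl]] show ?thesis
        by (simp add: g_def o_def)
    qed
    have contg: "continuous_on {\<tau>..t} (\<lambda>s. A (g s))"
      using deriv
      by (intro bounded_linear.continuous_on[OF bl])
        (meson continuous_on_eq_continuous_within has_vector_derivative_continuous)
    have int_g: "set_integrable lborel {\<tau>..t} (\<lambda>s. A (g s))"
      by (rule borel_integrable_atLeastAtMost'[OF contg])
    have int_g': "set_integrable lborel {\<tau><..t} (\<lambda>s. A (g s))"
      by (rule set_integrable_subset[OF int_g]) auto
    \<comment> \<open>At the junction the generator is still the old one, so the new piece is
      integrated over a half-open interval; the missing point is null.\<close>
    have eq: "L s (T s x) = A (g s)" if "s \<in> {\<tau><..t}" for s
      using that by (simp add: L_def T_def g_def)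
    have int_new: "set_integrable lborel {\<tau><..t} (\<lambda>s. L s (T s x))"
    proof -
      have "set_integrable lborel {\<tau><..t} (\<lambda>s. L s (T s x))
          = set_integrable lborel {\<tau><..t} (\<lambda>s. A (g s))"
        by (intro set_integrable_cong refl eq)
      with int_g' show ?thesis by simp
    qed
    have "(LINT s:{\<tau><..t}|lborel. L s (T s x)) = (LINT s:{\<tau><..t}|lborel. A (g s))"
      by (intro set_lebesgue_integral_cong) (auto simp: eq)
    also have "\<dots> = (LINT s:{\<tau>..t}|lborel. A (g s))"
    proof (rule set_integral_cong_set)
      show "set_borel_measurable lborel {\<tau>..t} (\<lambda>s. A (g s))"
        "set_borel_measurable lborel {\<tau><..t} (\<lambda>s. A (g s))"
        using int_g int_g' by (auto simp: set_integrable_def set_borel_measurable_def)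
      show "AE s in lborel. (s \<in> {\<tau>..t}) = (s \<in> {\<tau><..t})"
        using AE_lborel_singleton[of \<tau>] by eventually_elim auto
    qed
    also have "\<dots> = g t - g \<tau>"
      unfolding set_lebesgue_integral_def
      by (rule integral_FTC_atLeastAtMost) (use t deriv contg in auto)
    finally have new_val: "(LINT s:{\<tau><..t}|lborel. L s (T s x)) = g t - g \<tau>" .
    have un: "{0..t} = {0..\<tau>} \<union> {\<tau><..t}"
      using t \<tau> by auto
    note old' = old[OF \<tau> order_refl, of x]
    have "set_integrable lborel {0..t} (\<lambda>s. L s (T s x))"
      unfolding un using old' int_new by (intro set_integrable_Un) auto
    moreover have "(LINT s:{0..t}|lborel. L s (T s x))
        = (LINT s:{0..\<tau>}|lborel. L s (T s x)) + (LINT s:{\<tau><..t}|lborel. L s (T s x))"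
      unfolding un using old' int_new by (intro set_integral_Un) auto
    moreover have "g \<tau> = T \<tau> x" "g t = T t x"
      using t by (simp_all add: g_def T_def flow_0)
    ultimately show ?thesis
      using old' new_val by (simp add: algebra_simps)
  qed
  define c' where "c' = Plan (\<tau> + h) T L"
  have "Vector_Spaces.linear csmult csmult (T t)" if "t \<in> {0..\<tau> + h}" for t
  proof (cases "t \<le> \<tau>")
    case True
    then show ?thesis
      using that c by (auto simp: T_def plan_of_def \<tau>_def)
  next
    case False
    have "Vector_Spaces.linear csmult csmult (evol c \<tau>)"
      using c \<tau> by (simp add: plan_of_def \<tau>_def)
    then show ?thesis
      using False lindbladian_flow_linear[OF A(2), of "t - \<tau>"]
      by (simp add: T_def Vector_Spaces.linear_iff)
  qed
  moreover have "L t \<in> K" if "t \<in> {0..\<tau> + h}" for t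
    using that c A by (auto simp: L_def plan_of_def \<tau>_def)
  moreover have "T 0 = id"
    using c \<tau> by (simp add: T_def plan_of_def)
  ultimately have "plan_of K c'"
    using old new \<tau> h by (force simp: plan_of_def c'_def not_le)
  moreover have "T t \<rho> \<in> S" if "t \<in> {\<tau>..\<tau> + h}" for t
    using that S[of "t - \<tau>"] by (simp add: T_after \<tau>_def)
  ultimately have "extends K \<rho> S c c'"
    using h by (auto simp: extends_def c'_def agree_on_def T_def L_def \<tau>_def)
  moreover have "endpoint \<rho> c' = flow A h (endpoint \<rho> c)"
    using h by (simp add: c'_def T_after) (simp add: \<tau>_def)
  ultimately show ?thesis
    by (intro exI[of _ c']) (simp add: c'_def \<tau>_def)
qed

text \<open>The start of every construction. Even a plan of duration 0 needs a generator, since time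
  0 belongs to its interval.\<close>

lemma plan_of_trivial: "A \<in> K \<Longrightarrow> plan_of K (Plan 0 (\<lambda>_. id) (\<lambda>_. A))"
proof -
  have "set_integrable lborel {0..0} f" "(LINT s:{0..0}|lborel. f s) = 0" for f :: "real \<Rightarrow> 'a op"
  proof -
    show int: "set_integrable lborel {0..0} f"
      by (rule borel_integrable_atLeastAtMost') simp
    show "(LINT s:{0..0}|lborel. f s) = 0"
      unfolding set_lebesgue_integral_def
      by (rule integral_eq_zero_AE) (use AE_lborel_singleton[of 0] in eventually_elim, simp)
  qed
  moreover have "Vector_Spaces.linear csmult csmult (id :: 'a superop)"
    by (simp add: Vector_Spaces.linear_iff vector_space_csmult)
  moreover assume "A \<in> K"
  ultimately show ?thesis
    by (simp add: plan_of_def)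
qed

text \<open>States are mapped to states, and the generator is bounded on that compact set; this
  gives one speed limit for all initial states and all times.\<close>

lemma lindbladian_flow_near:
  fixes A :: "'n::finite superop"
  assumes A: "A \<in> lindbladians"
  obtains M where "0 < M" "\<And>x t. x \<in> states \<Longrightarrow> 0 \<le> t \<Longrightarrow> dist (flow A t x) x \<le> M * t"
proof -
  note bl = lindbladian_bounded_linear[OF A]
  have "bounded (A ` states)"
    using compact_imp_bounded[OF compact_states] bl by (rule bounded_linear_image)
  then obtain M where M: "0 < M" "\<And>x. x \<in> states \<Longrightarrow> norm (A x) \<le> M"
    unfolding bounded_pos by auto
  have "dist (flow A t x) x \<le> M * t" if x: "x \<in> states" and t: "0 \<le> t" for x t
  proof -
    have "norm (flow A t x - flow A 0 x) \<le> M * norm (t - 0)"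
    proof (rule differentiable_bound[of "{0..t}" _ "\<lambda>s h. h *\<^sub>R A (flow A s x)"])
      show "((\<lambda>t. flow A t x) has_derivative (\<lambda>h. h *\<^sub>R A (flow A s x))) (at s within {0..t})" for s
        using flow_has_vector_derivative[OF bl] by (simp add: has_vector_derivative_def)
      show "onorm (\<lambda>h. h *\<^sub>R A (flow A s x)) \<le> M" if "s \<in> {0..t}" for s
      proof (rule onorm_le)
        have "norm (A (flow A s x)) \<le> M"
          using M(2) lindbladian_flow_states[OF A x] that by simp
        then show "norm (k *\<^sub>R A (flow A s x)) \<le> M * norm k" for k
          by (simp add: mult.commute[of M] mult_left_mono)
      qed
    qed (use t in auto)
    then show ?thesis
      using t by (simp add: flow_0 dist_norm)
  qed
  with M(1) that show thesis by blast
qed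

text \<open>Everything the control construction asks of a Lyapunov function. One generator, one
  running time and one gain serve a full neighbourhood, and the weak inequality during the run keeps
  orbits inside sublevel sets. The bound at \<sigma> ensures that states with \<open>W\<close> above
  a positive level differ from \<sigma>.\<close>

locale lyapunov_control =
  fixes K :: "'n::finite superop set" and W :: "'n op \<Rightarrow> real" and \<sigma> :: "'n op"
  assumes K_lindbladians: "K \<subseteq> lindbladians" and K_nonempty: "K \<noteq> {}"
    and W_continuous: "continuous_on states W"
    and W_pos: "\<And>\<eta>. \<eta> \<in> states \<Longrightarrow> \<eta> \<noteq> \<sigma> \<Longrightarrow> 0 < W \<eta>" and W_\<sigma>: "W \<sigma> \<le> 0"
    and descent: "\<And>\<eta>. \<eta> \<in> states \<Longrightarrow> \<eta> \<noteq> \<sigma> \<Longrightarrow>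
      \<exists>A\<in>K. \<exists>r>0. \<exists>h\<ge>0. \<exists>d>0. \<forall>x\<in>states. dist \<eta> x < r \<longrightarrow>
        (\<forall>t\<in>{0..h}. W (flow A t x) \<le> W x) \<and> W (flow A h x) \<le> W x - d"
begin

definition sublevel :: "real \<Rightarrow> 'n op set" where
  "sublevel \<epsilon> = {\<eta> \<in> states. W \<eta> \<le> \<epsilon>}"

text \<open>Finitely many of the neighbourhoods from \<open>descent\<close> cover the compact set
  where \<open>W\<close> is at least \<delta>. Only the gain is made uniform; generator and running
  time still depend on the ball that contains \<open>x\<close>.\<close>

lemma uniform_descent:
  assumes "0 < \<delta>"
  shows "\<exists>d>0. \<forall>x\<in>states. \<delta> \<le> W x \<longrightarrow> (\<exists>A\<in>K. \<exists>h\<ge>0.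
    (\<forall>t\<in>{0..h}. W (flow A t x) \<le> W x) \<and> W (flow A h x) \<le> W x - d)"
proof -
  define C where "C = {\<eta> \<in> states. \<delta> \<le> W \<eta>}"
  have "compact C"
  proof -
    have C: "C = states \<inter> W -` {\<delta>..}"
      by (auto simp: C_def)
    have "closed C"
      unfolding C
      by (intro continuous_closed_preimage[OF W_continuous] compact_imp_closed compact_states closed_atLeast)
    from compact_Int_closed[OF compact_states this] show ?thesis
      by (simp add: C Int_absorb2 Int_assoc[symmetric])
  qed
  define Q where "Q = (\<lambda>d x. \<exists>A\<in>K. \<exists>h\<ge>0.
    (\<forall>t\<in>{0..h}. W (flow A t x) \<le> W x) \<and> W (flow A h x) \<le> W x - d)"
  have Q_mono: "Q d x \<Longrightarrow> d' \<le> d \<Longrightarrow> Q d' x" for d d' x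
    unfolding Q_def by (meson diff_left_mono order_trans)
  have "\<exists>r d. 0 < r \<and> 0 < d \<and> (\<forall>x\<in>states. dist \<eta> x < r \<longrightarrow> Q d x)" if "\<eta> \<in> C" for \<eta>
  proof -
    have "\<eta> \<in> states" "\<eta> \<noteq> \<sigma>"
      using that W_\<sigma> assms by (auto simp: C_def)
    from descent[OF this] obtain A r h d where "A \<in> K" "0 < r" "0 \<le> h" "0 < d"
      and "\<And>x. x \<in> states \<Longrightarrow> dist \<eta> x < r \<Longrightarrow>
        (\<forall>t\<in>{0..h}. W (flow A t x) \<le> W x) \<and> W (flow A h x) \<le> W x - d"
      by blast
    then show ?thesis
      unfolding Q_def by blast
  qed
  then obtain r d where *: "\<And>\<eta>. \<eta> \<in> C \<Longrightarrow> 0 < r \<eta>" "\<And>\<eta>. \<eta> \<in> C \<Longrightarrow> 0 < d \<eta>"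
    "\<And>\<eta> x. \<eta> \<in> C \<Longrightarrow> x \<in> states \<Longrightarrow> dist \<eta> x < r \<eta> \<Longrightarrow> Q (d \<eta>) x"
    by metis
  have "C \<subseteq> (\<Union>\<eta>\<in>C. ball \<eta> (r \<eta>))"
    using *(1) by auto
  then obtain D where D: "D \<subseteq> C" "finite D" "C \<subseteq> (\<Union>\<eta>\<in>D. ball \<eta> (r \<eta>))"
    using compactE_image[OF \<open>compact C\<close>, of C "\<lambda>\<eta>. ball \<eta> (r \<eta>)"] by auto
  \<comment> \<open>The extra 1 keeps the minimum meaningful if the cover is empty.\<close>
  define m where "m = Min (insert 1 (d ` D))"
  have "0 < m"
    using D *(2) by (auto simp: m_def)
  moreover have "Q m x" if x: "x \<in> states" "\<delta> \<le> W x" for x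
  proof -
    obtain \<eta> where \<eta>: "\<eta> \<in> D" "dist \<eta> x < r \<eta>"
      using x D(3) by (auto simp: C_def)
    then have "m \<le> d \<eta>"
      using D(2) by (auto simp: m_def)
    then show ?thesis
      using *(3)[of \<eta> x] \<eta> D(1) x(1) Q_mono by blast
  qed
  ultimately show ?thesis
    unfolding Q_def by blast
qed

text \<open>Each round lowers \<open>W\<close> by at least \<open>d\<close>, so the number of rounds
  between two levels is bounded in advance. The induction is on that number, encoded as
  \<open>W \<le> \<delta> + real n * d\<close>.\<close>

lemma reach_level:
  assumes \<delta>: "0 < \<delta>" and c: "plan_of K c" "endpoint \<rho> c \<in> sublevel \<epsilon>" and "\<delta> \<le> \<epsilon>"
  shows "\<exists>c'. extends K \<rho> (sublevel \<epsilon>) c c' \<and> endpoint \<rho> c' \<in> sublevel \<delta>"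
proof -
  from uniform_descent[OF \<delta>] obtain d where d: "0 < d"
    and descend: "\<forall>x\<in>states. \<delta> \<le> W x \<longrightarrow> (\<exists>A\<in>K. \<exists>h\<ge>0.
      (\<forall>t\<in>{0..h}. W (flow A t x) \<le> W x) \<and> W (flow A h x) \<le> W x - d)"
    by (elim exE conjE)
  have "\<exists>c'. extends K \<rho> (sublevel \<epsilon>) c c' \<and> endpoint \<rho> c' \<in> sublevel \<delta>"
    if "W (endpoint \<rho> c) \<le> \<delta> + real n * d" "plan_of K c" "endpoint \<rho> c \<in> sublevel \<epsilon>" for n c
    using that
  proof (induction n arbitrary: c)
    case 0
    then have "endpoint \<rho> c \<in> sublevel \<delta>"
      by (simp add: sublevel_def)
    with extends_refl[OF 0(2,3)] show ?case
      by blast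
  next
    case (Suc n)
    let ?x = "endpoint \<rho> c"
    show ?case
    proof (cases "W ?x \<le> \<delta>")
      case True
      then have "?x \<in> sublevel \<delta>"
        using Suc.prems(3) by (simp add: sublevel_def)
      with extends_refl[OF Suc.prems(2,3)] show ?thesis
        by blast
    next
      case False
      have x: "?x \<in> states" "W ?x \<le> \<epsilon>"
        using Suc.prems by (auto simp: sublevel_def)
      have "\<exists>A\<in>K. \<exists>h\<ge>0. (\<forall>t\<in>{0..h}. W (flow A t ?x) \<le> W ?x) \<and> W (flow A h ?x) \<le> W ?x - d"
        using bspec[OF descend x(1)] False by simp
      then obtain A h where A: "A \<in> K" "0 \<le> h" "\<And>t. t \<in> {0..h} \<Longrightarrow> W (flow A t ?x) \<le> W ?x"
        "W (flow A h ?x) \<le> W ?x - d"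
        by blast
      then have "A \<in> lindbladians"
        using K_lindbladians by blast
      then have "flow A t ?x \<in> sublevel \<epsilon>" if "t \<in> {0..h}" for t
        using A(3)[OF that] that x lindbladian_flow_states[of A ?x t] by (simp add: sublevel_def)
      then obtain c' where c': "extends K \<rho> (sublevel \<epsilon>) c c'" "endpoint \<rho> c' = flow A h ?x"
        using extends_flow[OF Suc.prems(2) A(1) \<open>A \<in> lindbladians\<close> A(2)] by metis
      have "W (endpoint \<rho> c') \<le> \<delta> + real n * d"
        using A(4) Suc.prems(1) c'(2) by (simp add: algebra_simps)
      then obtain c'' where "extends K \<rho> (sublevel \<epsilon>) c' c''" "endpoint \<rho> c'' \<in> sublevel \<delta>"
        using Suc.IH[OF _ extends_plan_of[OF c'(1)] extends_endpoint[OF c'(1)]] by blast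
      then show ?thesis
        using extends_trans[OF Suc.prems(2) c'(1)] by blast
    qed
  qed
  moreover obtain n :: nat where "\<epsilon> - \<delta> \<le> real n * d"
    using reals_Archimedean3[OF d] by (meson less_imp_le)
  moreover from this c(2) have "W (endpoint \<rho> c) \<le> \<delta> + real n * d"
    by (simp add: sublevel_def)
  ultimately show ?thesis
    using c by blast
qed

text \<open>
  The descent may converge in finite time.  To spend unit time below a level, descend to half of it
  and then apply an arbitrary generator for a short time, which is bounded below uniformly.
\<close>

lemma dwell:
  assumes \<epsilon>: "0 < \<epsilon>" and c: "plan_of K c" "endpoint \<rho> c \<in> sublevel \<epsilon>"
  shows "\<exists>c'. extends K \<rho> (sublevel \<epsilon>) c c' \<and> duration c + 1 \<le> duration c'"
proof -
  obtain A where A: "A \<in> K" "A \<in> lindbladians"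
    using K_nonempty K_lindbladians by blast
  obtain M where M: "0 < M" "\<And>x t. x \<in> states \<Longrightarrow> 0 \<le> t \<Longrightarrow> dist (flow A t x) x \<le> M * t"
    using lindbladian_flow_near[OF A(2)] by metis
  obtain r where r: "0 < r" "\<And>x y. x \<in> states \<Longrightarrow> y \<in> states \<Longrightarrow> dist y x < r \<Longrightarrow> dist (W y) (W x) < \<epsilon> / 2"
    using compact_uniformly_continuous[OF W_continuous compact_states] \<epsilon>
    unfolding uniformly_continuous_on_def by (metis half_gt_zero)
  \<comment> \<open>At speed at most \<open>M\<close> the orbit moves no further than
    \<open>r / 2\<close> in this time. As \<open>h\<close> depends neither on the plan nor on the
    round, finitely many rounds fill unit time.\<close>
  define h where "h = r / (2 * M)"
  have h: "0 < h"
    using r M by (simp add: h_def)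
  have stay: "flow A t x \<in> sublevel \<epsilon>" if x: "x \<in> sublevel (\<epsilon> / 2)" and t: "t \<in> {0..h}" for x t
  proof -
    have xs: "x \<in> states" and fs: "flow A t x \<in> states"
      using x t lindbladian_flow_states[OF A(2)] by (auto simp: sublevel_def)
    have "dist (flow A t x) x \<le> M * t"
      using M(2)[OF xs] t by simp
    also have "\<dots> \<le> M * h"
      using t M(1) by simp
    also have "\<dots> < r"
      using r M by (simp add: h_def)
    finally have "dist (W (flow A t x)) (W x) < \<epsilon> / 2"
      by (rule r(2)[OF xs fs])
    then have "W (flow A t x) < W x + \<epsilon> / 2"
      unfolding dist_real_def by linarith
    then show ?thesis
      using x fs by (simp add: sublevel_def)
  qed
  have "\<exists>c'. extends K \<rho> (sublevel \<epsilon>) c c' \<and> duration c + real n * h \<le> duration c'" for n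
  proof (induction n)
    case 0
    then show ?case
      using extends_refl[OF c] by auto
  next
    case (Suc n)
    then obtain c1 where c1: "extends K \<rho> (sublevel \<epsilon>) c c1" "duration c + real n * h \<le> duration c1"
      by blast
    obtain c2 where c2: "extends K \<rho> (sublevel \<epsilon>) c1 c2" "endpoint \<rho> c2 \<in> sublevel (\<epsilon> / 2)"
      using reach_level[of "\<epsilon> / 2" c1 \<rho> \<epsilon>] extends_plan_of[OF c1(1)] extends_endpoint[OF c1(1)] \<epsilon>
      by auto
    obtain c3 where c3: "extends K \<rho> (sublevel \<epsilon>) c2 c3" "duration c3 = duration c2 + h"
      using extends_flow[OF extends_plan_of[OF c2(1)] A less_imp_le[OF h] stay[OF c2(2)]] by blast
    have "extends K \<rho> (sublevel \<epsilon>) c c3"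
      by (rule extends_trans[OF c(1) c1(1) extends_trans[OF extends_plan_of[OF c1(1)] c2(1) c3(1)]])
    moreover have "duration c1 \<le> duration c2"
      using c2(1) by (rule extends_duration)
    ultimately show ?case
      using c1(2) c3(2) by (intro exI[of _ c3]) (simp add: algebra_simps)
  qed
  moreover obtain n :: nat where "1 \<le> real n * h"
    using reals_Archimedean3[OF h] by (meson less_imp_le)
  ultimately show ?thesis
    by (meson add_left_mono order_trans)
qed

text \<open>Each stage dwells for unit time below the current level and ends below the next. Hence
  the n-th plan lasts at least n, and the plans exhaust the half-line.\<close>

lemma plan_sequence:
  assumes \<rho>: "\<rho> \<in> states"
  shows "\<exists>c \<epsilon>. (\<forall>n. plan_of K (c n) \<and> real n \<le> duration (c n) \<and> 0 < \<epsilon> n \<and>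
      extends K \<rho> (sublevel (\<epsilon> n)) (c n) (c (Suc n))) \<and> decseq \<epsilon> \<and> \<epsilon> \<longlonglongrightarrow> 0"
proof -
  \<comment> \<open>The summand 1 keeps all levels positive even when \<open>W\<close> vanishes at
    \<rho>; the initial level dominates \<open>W \<rho>\<close>.\<close>
  define \<epsilon> where "\<epsilon> = (\<lambda>n. (\<bar>W \<rho>\<bar> + 1) * (1/2) ^ n)"
  have \<epsilon>: "0 < \<epsilon> n" "\<epsilon> (Suc n) \<le> \<epsilon> n" for n
    by (simp_all add: \<epsilon>_def add_nonneg_pos)
  have "\<exists>c. \<forall>n. (plan_of K (c n) \<and> real n \<le> duration (c n) \<and> endpoint \<rho> (c n) \<in> sublevel (\<epsilon> n)) \<and>
      extends K \<rho> (sublevel (\<epsilon> n)) (c n) (c (Suc n))"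
  proof (rule dependent_nat_choice)
    obtain A where "A \<in> K"
      using K_nonempty by blast
    from plan_of_trivial[OF this]
    show "\<exists>c. plan_of K c \<and> real 0 \<le> duration c \<and> endpoint \<rho> c \<in> sublevel (\<epsilon> 0)"
      using \<rho> by (intro exI[of _ "Plan 0 (\<lambda>_. id) (\<lambda>_. A)"]) (simp add: sublevel_def \<epsilon>_def)
  next
    fix c n
    assume c: "plan_of K c \<and> real n \<le> duration c \<and> endpoint \<rho> c \<in> sublevel (\<epsilon> n)"
    then obtain c1 where c1: "extends K \<rho> (sublevel (\<epsilon> n)) c c1" "duration c + 1 \<le> duration c1"
      using dwell[OF \<epsilon>(1)] by blast
    moreover obtain c2 where c2: "extends K \<rho> (sublevel (\<epsilon> n)) c1 c2" "endpoint \<rho> c2 \<in> sublevel (\<epsilon> (Suc n))"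
      using reach_level[OF \<epsilon>(1) extends_plan_of[OF c1(1)] extends_endpoint[OF c1(1)] \<epsilon>(2)] by blast
    moreover have "extends K \<rho> (sublevel (\<epsilon> n)) c c2"
      using c extends_trans[OF _ c1(1) c2(1)] by blast
    ultimately show "\<exists>y. (plan_of K y \<and> real (Suc n) \<le> duration y \<and> endpoint \<rho> y \<in> sublevel (\<epsilon> (Suc n))) \<and>
        extends K \<rho> (sublevel (\<epsilon> n)) c y"
      using c extends_plan_of[OF c2(1)] extends_duration[OF c2(1)] by (intro exI[of _ c2]) auto
  qed
  moreover have "\<epsilon> \<longlonglongrightarrow> 0"
    unfolding \<epsilon>_def by (intro tendsto_mult_right_zero LIMSEQ_power_zero) simp
  moreover have "decseq \<epsilon>"
    using \<epsilon>(2) by (simp add: decseq_Suc_iff)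
  ultimately show ?thesis
    using \<epsilon>(1) by blast
qed

theorem reaches_target: "reaches K \<sigma>"
  unfolding reaches_def
proof
  fix \<rho> :: "'n op"
  assume "\<rho> \<in> states"
  then obtain c \<epsilon> where plan: "\<And>n. plan_of K (c n)" and dur: "\<And>n. real n \<le> duration (c n)"
    and ext: "\<And>n. extends K \<rho> (sublevel (\<epsilon> n)) (c n) (c (Suc n))"
    and \<epsilon>: "decseq \<epsilon>" "\<epsilon> \<longlonglongrightarrow> 0"
    using plan_sequence by blast
  have agree: "evol (c m) t = evol (c n) t \<and> gen (c m) t = gen (c n) t"
    if "n \<le> m" "0 \<le> t" "t \<le> duration (c n)" for n m t
    using that
  proof (induction m rule: dec_induct)
    case (step m)
    have "duration (c n) \<le> duration (c m)"
      using step.hyps(1) ext lift_Suc_mono_le[of "\<lambda>n. duration (c n)"] by (simp add: extends_def)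
    then show ?case
      using step ext[of m] by (simp add: extends_def agree_on_def)
  qed simp
  \<comment> \<open>Rounding up selects a plan long enough to cover time \<open>t\<close>; by nested
    agreement any other such plan gives the same value.\<close>
  define N where "N = (\<lambda>t::real. nat \<lceil>t\<rceil>)"
  define T where "T = (\<lambda>t. evol (c (N t)) t)"
  define L where "L = (\<lambda>t. gen (c (N t)) t)"
  have N: "t \<le> duration (c (N t))" for t
    using dur[of "N t"] real_nat_ceiling_ge[of t] by (simp add: N_def)
  have TL: "T t = evol (c n) t" "L t = gen (c n) t" if "0 \<le> t" "t \<le> duration (c n)" for t n
    using agree[of n "N t" t] agree[of "N t" n t] N[of t] that
    by (auto simp: T_def L_def) (metis nle_le)+
  have T0: "T 0 = id"
    using plan by (simp add: T_def plan_of_def N_def)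
  have "evolution T" "\<forall>t\<ge>0. L t \<in> K"
    using plan N T0 by (auto simp: evolution_def T_def L_def plan_of_def)
  moreover have "weak_solution L T"
    unfolding weak_solution_def
  proof (intro allI impI)
    fix x and t :: real
    assume t: "0 \<le> t"
    let ?c = "c (N t)"
    have eq: "L s (T s x) = gen ?c s (evol ?c s x)" if "s \<in> {0..t}" for s
      using that N[of t] TL[of s "N t"] by simp
    have "set_integrable lborel {0..t} (\<lambda>s. gen ?c s (evol ?c s x))"
      "evol ?c t x = x + (LINT s:{0..t}|lborel. gen ?c s (evol ?c s x))"
      using plan[of "N t"] t N[of t] by (auto simp: plan_of_def)
    moreover have "set_integrable lborel {0..t} (\<lambda>s. L s (T s x))
        = set_integrable lborel {0..t} (\<lambda>s. gen ?c s (evol ?c s x))"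
      by (intro set_integrable_cong refl eq)
    moreover have "(LINT s:{0..t}|lborel. L s (T s x)) = (LINT s:{0..t}|lborel. gen ?c s (evol ?c s x))"
      by (intro set_lebesgue_integral_cong) (auto simp: eq)
    ultimately show "set_integrable lborel {0..t} (\<lambda>s. L s (T s x)) \<and>
        T t x = T 0 x + (LINT s:{0..t}|lborel. L s (T s x))"
      by (simp add: T0) (simp add: T_def)
  qed
  ultimately have "admissible K T"
    by (auto simp: admissible_def)
  moreover have "((\<lambda>t. T t \<rho>) \<longlongrightarrow> \<sigma>) at_top"
  proof -
    \<comment> \<open>Once the n-th plan has ended, \<open>t\<close> falls into some stage m with m
      at least n, whose level is no larger because the levels decrease.\<close>
    have level: "T t \<rho> \<in> sublevel (\<epsilon> n)" if t: "duration (c n) \<le> t" for n t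
    proof -
      have "0 \<le> duration (c n)"
        using plan by (simp add: plan_of_def)
      have "T t \<rho> \<in> sublevel (\<epsilon> n)" if "n \<le> m" "t \<le> duration (c (Suc m))" "duration (c n) \<le> t" for m
        using that
      proof (induction m rule: dec_induct)
        case base
        then show ?case
          using ext[of n] TL[of t "Suc n"] \<open>0 \<le> duration (c n)\<close> by (simp add: extends_def)
      next
        case (step m)
        show ?case
        proof (cases "t \<le> duration (c (Suc m))")
          case False
          then have "T t \<rho> \<in> sublevel (\<epsilon> (Suc m))"
            using ext[of "Suc m"] TL[of t "Suc (Suc m)"] step.prems \<open>0 \<le> duration (c n)\<close>
            by (simp add: extends_def)
          moreover have "\<epsilon> (Suc m) \<le> \<epsilon> n"
            using \<epsilon>(1) step.hyps by (simp add: decseq_def)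
          ultimately show ?thesis
            by (simp add: sublevel_def)
        qed (use step in simp)
      qed
      moreover have "t \<le> duration (c (Suc (max n (N t))))"
      proof -
        have "t \<le> real (Suc (max n (N t)))"
          using real_nat_ceiling_ge[of t] by (simp add: N_def)
        then show ?thesis
          using dur order_trans by blast
      qed
      ultimately show ?thesis
        using t by (meson max.cobounded1)
    qed
    show ?thesis
    proof (rule tendstoI)
      fix e :: real
      assume "0 < e"
      define F where "F = states - ball \<sigma> e"
      have "compact F"
        unfolding F_def by (intro compact_diff compact_states open_ball)
      \<comment> \<open>On the compact set of states outside the ball, \<open>W\<close> has a
        positive minimum, so small values of \<open>W\<close> force closeness to \<sigma>. If that
        set is empty, any positive \<open>m\<close> serves.\<close>
      obtain m where m: "0 < m" "\<And>x. x \<in> F \<Longrightarrow> m \<le> W x"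
      proof (cases "F = {}")
        case False
        have "continuous_on F W"
          using W_continuous by (rule continuous_on_subset) (auto simp: F_def)
        then obtain x where x: "x \<in> F" "\<And>y. y \<in> F \<Longrightarrow> W x \<le> W y"
          using continuous_attains_inf[OF \<open>compact F\<close> False] by blast
        have "0 < W x"
          using x(1) \<open>0 < e\<close> by (intro W_pos) (auto simp: F_def)
        with x(2) that show thesis by blast
      qed (use that[of 1] in auto)
      obtain n where n: "\<epsilon> n < m"
        using order_tendstoD(2)[OF \<epsilon>(2) m(1)] by (auto simp: eventually_sequentially)
      have "dist (T t \<rho>) \<sigma> < e" if "duration (c n) \<le> t" for t
      proof -
        have "T t \<rho> \<in> states" "W (T t \<rho>) < m"
          using level[OF that] n by (auto simp: sublevel_def)
        then have "T t \<rho> \<notin> F"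
          using m(2) by fastforce
        then show ?thesis
          using \<open>T t \<rho> \<in> states\<close> by (simp add: F_def dist_commute)
      qed
      then show "\<forall>\<^sub>F t in at_top. dist (T t \<rho>) \<sigma> < e"
        by (auto simp: eventually_at_top_linorder)
    qed
  qed
  ultimately show "\<exists>T. admissible K T \<and> ((\<lambda>t. T t \<rho>) \<longlongrightarrow> \<sigma>) at_top"
    by blast
qed

end

section \<open>The Schatten power as a Lyapunov function\<close>

lemma hermitian_diff: "hermitian X \<Longrightarrow> hermitian Y \<Longrightarrow> hermitian (X - Y)"
  by (simp add: hermitian_def adj_diff)

lemma continuous_on_signed_power_states:
  fixes \<sigma> :: "'n::finite op"
  assumes p: "1 < p" and \<sigma>: "\<sigma> \<in> states"
  shows "continuous_on states (\<lambda>\<eta>. signed_power p (\<eta> - \<sigma>))"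
proof -
  have "bounded ((\<lambda>\<eta>. \<eta> - \<sigma>) ` states)"
    by (intro compact_imp_bounded compact_continuous_image compact_states continuous_intros)
  then obtain R where R: "\<And>\<eta>. \<eta> \<in> states \<Longrightarrow> norm (\<eta> - \<sigma>) \<le> R"
    by (auto simp: bounded_iff)
  show ?thesis
    by (rule continuous_on_compose2[OF continuous_on_signed_power[OF p, where R = R]])
      (use \<sigma> R in \<open>auto intro!: continuous_intros hermitian_diff intro: states_hermitian\<close>)
qed

text \<open>Provides the neighbourhood form of descent from strict negativity at the single state
  \<eta>. Klein's inequality compares the start of the orbit directly with its end, so every
  intermediate time yields a linear decrease of rate \<open>p * c\<close>.\<close>

lemma schatten_descent:
  fixes A :: "'n::finite superop" and \<sigma> :: "'n op"
  defines "W p \<equiv> \<lambda>\<eta>. schatten_pow p (\<eta> - \<sigma>)"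
  assumes p: "1 < p" and A: "A \<in> lindbladians" and \<sigma>: "\<sigma> \<in> states" and \<eta>: "\<eta> \<in> states"
    and neg: "Re (trace (A \<eta> ** signed_power p (\<eta> - \<sigma>))) < 0"
  shows "\<exists>r>0. \<exists>h\<ge>0. \<exists>d>0. \<forall>x\<in>states. dist \<eta> x < r \<longrightarrow>
      (\<forall>t\<in>{0..h}. W p (flow A t x) \<le> W p x) \<and> W p (flow A h x) \<le> W p x - d"
proof -
  note bl = lindbladian_bounded_linear[OF A]
  \<comment> \<open>The state on which the generator acts and the state at which the gradient is
    taken are separated, because they occur at different times of the orbit.\<close>
  define G where "G = (\<lambda>(y, z). Re (trace (A y ** signed_power p (z - \<sigma>))))"
  \<comment> \<open>Half of the rate at \<eta> is kept; the other half absorbs the variation of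
    \<open>G\<close> nearby.\<close>
  define c where "c = - G (\<eta>, \<eta>) / 2"
  have c: "0 < c"
    using neg by (simp add: c_def G_def)
  have "continuous_on (states \<times> states) (\<lambda>x. signed_power p (snd x - \<sigma>))"
    by (rule continuous_on_compose2[OF continuous_on_signed_power_states[OF p \<sigma>]])
      (auto intro!: continuous_intros)
  then have "continuous_on (states \<times> states) G"
    unfolding G_def case_prod_unfold
    by (intro continuous_intros bounded_linear.continuous_on[OF bl])
  then obtain r where r: "0 < r" "\<And>x. x \<in> states \<times> states \<Longrightarrow> dist x (\<eta>, \<eta>) < r \<Longrightarrow> dist (G x) (G (\<eta>, \<eta>)) < c"
    using c \<eta> unfolding continuous_on_iff by (metis SigmaI)
  have near: "G (y, z) \<le> - c" if "y \<in> states" "z \<in> states" "dist y \<eta> < r / 2" "dist z \<eta> < r / 2" for y z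
  proof -
    have "dist (y, z) (\<eta>, \<eta>) \<le> dist y \<eta> + dist z \<eta>"
      unfolding dist_Pair_Pair by (rule sqrt_sum_squares_le_sum) auto
    then have "dist (G (y, z)) (G (\<eta>, \<eta>)) < c"
      using that by (intro r(2)) auto
    then show ?thesis
      unfolding dist_real_def c_def by linarith
  qed
  obtain M where M: "0 < M" "\<And>x t. x \<in> states \<Longrightarrow> 0 \<le> t \<Longrightarrow> dist (flow A t x) x \<le> M * t"
    using lindbladian_flow_near[OF A] by metis
  \<comment> \<open>Starting within \<open>r / 4\<close> of \<eta> and moving by at most
    \<open>r / 4\<close>, the orbit stays within \<open>r / 2\<close>, where \<open>near\<close>
    applies in both arguments.\<close>
  define h where "h = r / (4 * M)"
  have h: "0 < h" "M * h = r / 4"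
    using r M by (auto simp: h_def)
  have descend: "W p (flow A t x) \<le> W p x - p * c * t"
    if x: "x \<in> states" "dist \<eta> x < r / 4" and t: "t \<in> {0..h}" for x t
  proof -
    have fs: "flow A s x \<in> states" and fd: "dist (flow A s x) \<eta> < r / 2" if s: "s \<in> {0..t}" for s
    proof -
      show "flow A s x \<in> states"
        using s x lindbladian_flow_states[OF A] by simp
      have "M * s \<le> M * h"
        using s t M(1) by simp
      then have "dist (flow A s x) x \<le> r / 4"
        using M(2)[of x s] x s h by simp
      then show "dist (flow A s x) \<eta> < r / 2"
        using x(2) dist_triangle[of "flow A s x" \<eta> x] by (simp add: dist_commute)
    qed
    define z where "z = flow A t x"
    \<comment> \<open>The gradient is frozen at the endpoint \<open>z\<close>. Thus \<phi> is a
      linear image of the orbit, and its slope at time \<open>s\<close> is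
      \<open>G (flow A s x, z)\<close>.\<close>
    define \<phi> where "\<phi> = (\<lambda>s. Re (trace (flow A s x ** signed_power p (z - \<sigma>))))"
    have "bounded_linear (\<lambda>y. Re (trace (y ** signed_power p (z - \<sigma>))))"
      by (intro bounded_linear_compose[OF bounded_linear_Re]
          bounded_linear_compose[OF bounded_linear_trace]
          bounded_bilinear.bounded_linear_left[OF bounded_bilinear_matrix_mult])
    from bounded_linear.has_vector_derivative[OF this flow_has_vector_derivative[OF bl]]
    have d\<phi>: "(\<phi> has_real_derivative G (flow A s x, z)) (at s within X)" for s X
      by (simp add: \<phi>_def G_def has_real_derivative_iff_has_vector_derivative)
    have "\<phi> t - \<phi> 0 \<le> - c * t"
    proof (cases "t = 0")
      case False
      then have "0 < t" using t by simp
      then obtain s where s: "0 < s" "s < t" "\<phi> t - \<phi> 0 = (t - 0) * G (flow A s x, z)"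
        using MVT2[of 0 t \<phi> "\<lambda>s. G (flow A s x, z)"] d\<phi> by blast
      have "G (flow A s x, z) \<le> - c"
        using fs fd s(1,2) \<open>0 < t\<close> unfolding z_def by (intro near) auto
      then show ?thesis
        using s(3) \<open>0 < t\<close> mult_left_mono[of "G (flow A s x, z)" "- c" t] by (simp add: mult.commute)
    qed simp
    moreover have "W p z - W p x \<le> p * Re (trace (((z - \<sigma>) - (x - \<sigma>)) ** signed_power p (z - \<sigma>)))"
      unfolding W_def z_def using fs[of t] t x(1) \<sigma> p
      by (intro klein_schatten_pow hermitian_diff states_hermitian) auto
    moreover have "Re (trace (((z - \<sigma>) - (x - \<sigma>)) ** signed_power p (z - \<sigma>))) = \<phi> t - \<phi> 0"
      by (simp add: \<phi>_def z_def flow_0 bounded_bilinear.diff_left[OF bounded_bilinear_matrix_mult] trace_sub)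
    ultimately have "W p z - W p x \<le> p * (- c * t)"
      using p by (smt (verit) mult_left_mono)
    then show ?thesis
      by (simp add: z_def mult.assoc)
  qed
  show ?thesis
  proof (intro exI conjI ballI impI)
    show "0 < r / 4" "0 \<le> h" "0 < p * c * h"
      using r h c p by auto
    fix x :: "'n op"
    assume x: "x \<in> states" "dist \<eta> x < r / 4"
    show "W p (flow A h x) \<le> W p x - p * c * h"
      using descend[OF x] h by simp
    fix t
    assume t: "t \<in> {0..h}"
    then have "0 \<le> p * c * t"
      using p c by simp
    then show "W p (flow A t x) \<le> W p x"
      using descend[OF x t] by linarith
  qed
qed

theorem theorem4p4:
  fixes p :: real
    and K :: "'n::finite superop set"
    and \<sigma> :: "'n op"
    and L :: "'n op \<Rightarrow> 'n superop"
  assumes "1 < p"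
    and "K \<subseteq> lindbladians"
    and "\<sigma> \<in> states"
    and "\<And>\<eta>. \<eta> \<in> states \<Longrightarrow> L \<eta> \<in> K"
    and "\<And>\<eta>. \<eta> \<in> states \<Longrightarrow> \<eta> \<noteq> \<sigma> \<Longrightarrow>
           Re (trace (L \<eta> \<eta> ** signed_power p (\<eta> - \<sigma>))) < 0"
  shows "reaches K \<sigma>"
proof -
  have herm: "hermitian (\<eta> - \<sigma>)" if "\<eta> \<in> states" for \<eta>
    using that assms(3) by (intro hermitian_diff states_hermitian)
  interpret lyapunov_control K "\<lambda>\<eta>. schatten_pow p (\<eta> - \<sigma>)" \<sigma>
  proof
    \<comment> \<open>Since \<sigma> is itself a state, \<open>L \<sigma>\<close> witnesses that
      \<open>K\<close> is nonempty.\<close>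
    show "K \<subseteq> lindbladians" "K \<noteq> {}"
      using assms(2-4) by auto
    show "continuous_on states (\<lambda>\<eta>. schatten_pow p (\<eta> - \<sigma>))"
      unfolding schatten_pow_def
      by (intro continuous_intros continuous_on_signed_power_states assms)
    show "0 < schatten_pow p (\<eta> - \<sigma>)" if "\<eta> \<in> states" "\<eta> \<noteq> \<sigma>" for \<eta>
      using schatten_pow_nonneg[OF herm assms(1)] schatten_pow_eq_0D[OF herm assms(1)] that
      by (metis eq_iff_diff_eq_0 order_less_le)
    show "schatten_pow p (\<sigma> - \<sigma>) \<le> 0"
      by (simp add: schatten_pow_def bounded_bilinear.zero_left[OF bounded_bilinear_matrix_mult] trace_def)
    show "\<exists>A\<in>K. \<exists>r>0. \<exists>h\<ge>0. \<exists>d>0. \<forall>x\<in>states. dist \<eta> x < r \<longrightarrow>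
        (\<forall>t\<in>{0..h}. schatten_pow p (flow A t x - \<sigma>) \<le> schatten_pow p (x - \<sigma>)) \<and>
        schatten_pow p (flow A h x - \<sigma>) \<le> schatten_pow p (x - \<sigma>) - d"
      if "\<eta> \<in> states" "\<eta> \<noteq> \<sigma>" for \<eta>
      using assms that by (intro bexI[of _ "L \<eta>"] schatten_descent) auto
  qed
  show ?thesis
    by (rule reaches_target)
qed

end
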